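(* The three functionals $\mathrm{mnts}_1$, $\mathrm{mnts}$ and $\mathrm{mnts}^{(4)}$ are conformally invariant: for every knot $K\subset S^3$ and every conformal transformation $g$ of $S^3$, $$\mathrm{mnts}_1(g\cdot K)=\mathrm{mnts}_1(K),\qquad \mathrm{mnts}(g\cdot K)=\mathrm{mnts}(K),\qquad \mathrm{mnts}^{(4)}(g\cdot K)=\mathrm{mnts}^{(4)}(K).$$
   Context: A knot $K$ is the image of an embedding of $S^1$ of class $C^2$ into $S^3=\mathbb{R}^3\cup\{\infty\}$. The conformal group $\mathcal{G}$ of $S^3$ is generated by reflections (inversions) in 2-spheres. Spheres include planes. $\Lambda$ denotes the set of oriented 2-spheres in $S^3$. It is identified with $\{x\in\mathbb{R}^5: L(x,x)=1\}$, $L$ the Lorentz form of signature $(4,1)$, and carries the $\mathcal{G}$-invariant measure $d\Sigma=|\iota_x(dx_1\wedge\cdots\wedge dx_5)|$ at $x\in\Lambda$; in terms of the Euclidean center $(X,Y,Z)$ and radius $r$ of a sphere in $\mathbb{R}^3$ it is $d\Sigma=\frac{1}{r^4}|dX\wedge dY\wedge dZ\wedge dr|$. An oriented 2-sphere $\Sigma$ is a non-trivial sphere for $K$ if it intersects $K$ in at least 4 points counted with multiplicity; $\overline{NT}(K)\subset\Lambda$ is the set of these, and $\mathrm{mnts}_1(K)$ is the $d\Sigma$-measure of $\overline{NT}(K)$. An oriented 2-sphere $\Sigma=\partial D^3$ ($D^3$ being the side determined by the orientation) is a non-trivial sphere in the strict sense for $K$ if $\mathrm{Int}\,D^3\cap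 K$ contains at least 2 connected components of $K\setminus\Sigma$; $NT(K)\subset\Lambda$ is the set of these. With $n=n_K(\Sigma)=\frac12\sharp(\Sigma\cap K)$ (intersection points counted with multiplicity), put $$\mathrm{mnts}(K)=\int_{NT(K)}\binom{n}{2}\,d\Sigma,\qquad \mathrm{mnts}^{(4)}(K)=\int_{NT(K)}\binom{2n}{4}\,d\Sigma .$$ These take values in $[0,\infty]$. *)

theory Defs
  imports
    "HOL-Analysis.Analysis"
    "HOL-Library.Landau_Symbols"
    "HOL-Algebra.Bij"
    "HOL-Algebra.Generated_Groups"
begin

section \<open>The three-sphere and its conformal group\<close>

text \<open>\<open>S\<^sup>3 = \<real>\<^sup>3 \<union> {\<infinity>}\<close>, with \<open>\<infinity>\<close> represented by \<^term>\<open>None\<close>.  Topology and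
  differentiable structure are those of the unit sphere of \<open>\<real>\<^sup>4\<close>, transported by
  stereographic projection.\<close>

type_synonym S3 = "(real^3) option"

fun stereo :: "S3 \<Rightarrow> real^4" where
  "stereo None = vector [0, 0, 0, 1]"
| "stereo (Some p) =
     (1 / ((norm p)\<^sup>2 + 1)) *\<^sub>R vector [2 * p$1, 2 * p$2, 2 * p$3, (norm p)\<^sup>2 - 1]"

fun inversion :: "real^3 \<Rightarrow> real \<Rightarrow> S3 \<Rightarrow> S3" where
  "inversion c r None = Some c"
| "inversion c r (Some p) =
     (if p = c then None else Some (c + (r\<^sup>2 / (norm (p - c))\<^sup>2) *\<^sub>R (p - c)))"

text \<open>Reflection in the plane \<open>{p. a \<bullet> p = b}\<close>, for \<open>a \<noteq> 0\<close>.\<close>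

fun plane_reflection :: "real^3 \<Rightarrow> real \<Rightarrow> S3 \<Rightarrow> S3" where
  "plane_reflection a b None = None"
| "plane_reflection a b (Some p) = Some (p - (2 * (a \<bullet> p - b) / (a \<bullet> a)) *\<^sub>R a)"

definition sphere_reflections :: "(S3 \<Rightarrow> S3) set" where
  "sphere_reflections =
     {inversion c r | c r. r > 0} \<union> {plane_reflection a b | a b. a \<noteq> 0}"

definition conformal_group :: "(S3 \<Rightarrow> S3) set" where
  "conformal_group = generate (BijGroup UNIV) sphere_reflections"

definition knot :: "S3 set \<Rightarrow> bool" where
  "knot K \<longleftrightarrow> (\<exists>\<gamma> :: complex \<Rightarrow> S3.
     K = \<gamma> ` sphere 0 1 \<and> inj_on \<gamma> (sphere 0 1) \<and>
     (\<exists>c' c''. (\<forall>t. ((\<lambda>t. stereo (\<gamma> (cis t))) has_vector_derivative c' t) (at t) \<and>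
                   (c' has_vector_derivative c'' t) (at t) \<and> c' t \<noteq> 0) \<and>
              continuous_on UNIV c''))"


section \<open>The space of oriented spheres\<close>

definition lorentz :: "real^5 \<Rightarrow> real^5 \<Rightarrow> real" where
  "lorentz x y = x$1 * y$1 + x$2 * y$2 + x$3 * y$3 + x$4 * y$4 - x$5 * y$5"

definition oriented_spheres :: "(real^5) set" where
  "oriented_spheres = {x. lorentz x x = 1}"

text \<open>The unit sphere of \<open>\<real>\<^sup>4\<close> is the section of the light cone by the hyperplane where the
  last coordinate is \<open>1\<close>; the vector \<open>x\<close> represents the sphere cut out by its Lorentz-orthogonal
  hyperplane.  The side \<open>D\<^sup>3\<close> determined by the orientation is taken to be the one where the
  product with \<open>x\<close> is nonnegative, so that \<open>-x\<close> is the same sphere with the other orientation.\<close>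

definition sphere_fun :: "real^5 \<Rightarrow> real^4 \<Rightarrow> real" where
  "sphere_fun x q = lorentz x (vector [q$1, q$2, q$3, q$4, 1])"

definition sphere_of :: "real^5 \<Rightarrow> S3 set" where
  "sphere_of x = {z. sphere_fun x (stereo z) = 0}"

definition int_ball_of :: "real^5 \<Rightarrow> S3 set" where
  "int_ball_of x = {z. sphere_fun x (stereo z) > 0}"


section \<open>The invariant measure\<close>

text \<open>The value of the four-form \<open>\<iota>\<^sub>x (dx\<^sub>1 \<and> \<dots> \<and> dx\<^sub>5)\<close> on tangent vectors.\<close>

definition iota_vol :: "real^5 \<Rightarrow> (4 \<Rightarrow> real^5) \<Rightarrow> real" where
  "iota_vol x v = det (vector [x, v 1, v 2, v 3, v 4] :: real^5^5)"

definition C1_param :: "(real^4) set \<Rightarrow> (real^4 \<Rightarrow> real^5) \<Rightarrow> (real^4 \<Rightarrow> real^4 \<Rightarrow> real^5) \<Rightarrow> bool" where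
  "C1_param U \<phi> \<phi>' \<longleftrightarrow>
     open U \<and> \<phi> ` U \<subseteq> oriented_spheres \<and> inj_on \<phi> U \<and>
     (\<forall>u\<in>U. (\<phi> has_derivative \<phi>' u) (at u) \<and> inj (\<phi>' u)) \<and>
     (\<forall>v. continuous_on U (\<lambda>u. \<phi>' u v))"

text \<open>The measure of a density on a manifold: in every local parametrization it is the integral
  of the pulled back density.  See \<open>sphere_measure_exists\<close> and
  \<open>sphere_measure_unique\<close> below.\<close>

definition is_sphere_measure :: "(real^5) measure \<Rightarrow> bool" where
  "is_sphere_measure M \<longleftrightarrow>
     sets M = sets (restrict_space borel oriented_spheres) \<and>
     (\<forall>U \<phi> \<phi>'. C1_param U \<phi> \<phi>' \<longrightarrow>
        (\<forall>A \<in> sets borel. A \<subseteq> \<phi> ` U \<longrightarrow>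
           emeasure M A =
             (\<integral>\<^sup>+ u \<in> {u\<in>U. \<phi> u \<in> A}. ennreal \<bar>iota_vol (\<phi> u) (\<lambda>i. \<phi>' u (axis i 1))\<bar> \<partial>lborel)))"

text \<open>Completed, since \<^const>\<open>emeasure\<close> and \<^const>\<open>nn_integral\<close> are only meaningful on
  measurable arguments, and the sets of non-trivial spheres are a priori Borel only up to
  null sets.\<close>

definition dSigma :: "(real^5) measure" where
  "dSigma = completion (THE M. is_sphere_measure M)"


section \<open>Non-trivial spheres\<close>

text \<open>The intersection multiplicity is the order of vanishing along \<open>K\<close> of the equation of the
  sphere: it is at least \<open>j + 1\<close> iff the equation is \<open>o(s\<^sup>j)\<close>, where for a \<open>C\<^sup>2\<close> knot the chordal
  distance is comparable to the difference \<open>s\<close> of parameters.  For \<open>j \<le> 2\<close> this says that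
  the derivatives up to order \<open>j\<close> vanish; it also makes sense for higher contact, where
  these need not exist.\<close>

definition multiplicity_at :: "S3 set \<Rightarrow> real^5 \<Rightarrow> S3 \<Rightarrow> enat" where
  "multiplicity_at K x z =
     Sup {enat (Suc j) | j. sphere_fun x \<in>
            o[at (stereo z) within stereo ` K](\<lambda>q. norm (q - stereo z) ^ j)}"

definition intersection_count :: "S3 set \<Rightarrow> real^5 \<Rightarrow> enat" where
  "intersection_count K x =
     (if finite (sphere_of x \<inter> K) then \<Sum>z \<in> sphere_of x \<inter> K. multiplicity_at K x z else \<infinity>)"

definition half_count :: "S3 set \<Rightarrow> real^5 \<Rightarrow> ennreal" where
  "half_count K x = ennreal_of_enat (intersection_count K x) / 2"

definition NT_bar :: "S3 set \<Rightarrow> (real^5) set" where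
  "NT_bar K = {x \<in> oriented_spheres. intersection_count K x \<ge> 4}"

definition NT :: "S3 set \<Rightarrow> (real^5) set" where
  "NT K = {x \<in> oriented_spheres. \<exists>C1 C2. C1 \<noteq> C2 \<and>
     C1 \<in> components (stereo ` (K - sphere_of x)) \<and> C1 \<subseteq> stereo ` int_ball_of x \<and>
     C2 \<in> components (stereo ` (K - sphere_of x)) \<and> C2 \<subseteq> stereo ` int_ball_of x}"

text \<open>Binomial coefficient with a possibly half-integral or infinite upper argument.
  On \<^term>\<open>NT K\<close> the argument is at least \<open>k\<close>, so that the coefficient is nonnegative.\<close>

definition ennreal_gchoose :: "ennreal \<Rightarrow> nat \<Rightarrow> ennreal" where
  "ennreal_gchoose n k = (if n = \<infinity> then \<infinity> else ennreal (enn2real n gchoose k))"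

definition mnts1 :: "S3 set \<Rightarrow> ennreal" where
  "mnts1 K = emeasure dSigma (NT_bar K)"

definition mnts :: "S3 set \<Rightarrow> ennreal" where
  "mnts K = (\<integral>\<^sup>+ x \<in> NT K. ennreal_gchoose (half_count K x) 2 \<partial>dSigma)"

definition mnts4 :: "S3 set \<Rightarrow> ennreal" where
  "mnts4 K = (\<integral>\<^sup>+ x \<in> NT K. ennreal_gchoose (2 * half_count K x) 4 \<partial>dSigma)"


section \<open>The represented sphere in Euclidean terms\<close>

lemma exhaust_5:
  fixes x :: 5
  shows "x = 1 \<or> x = 2 \<or> x = 3 \<or> x = 4 \<or> x = 5"
proof (induct x)
  case (of_int z)
  then have "z = 0 \<or> z = 1 \<or> z = 2 \<or> z = 3 \<or> z = 4" by fastforce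
  then show ?case by auto
qed

lemma forall_5: "(\<forall>i::5. P i) \<longleftrightarrow> P 1 \<and> P 2 \<and> P 3 \<and> P 4 \<and> P 5"
  by (metis exhaust_5)

lemma UNIV_5: "UNIV = {1, 2, 3, 4, 5::5}"
  using exhaust_5 by auto

lemma sum_5: "sum f (UNIV::5 set) = f 1 + f 2 + f 3 + f 4 + f 5"
  unfolding UNIV_5 by (simp add: ac_simps)

lemma prod_5: "prod f (UNIV::5 set) = f 1 * f 2 * f 3 * f 4 * f 5"
  unfolding UNIV_5 by (simp add: ac_simps)

lemma prod_4: "prod f (UNIV::4 set) = f 1 * f 2 * f 3 * f 4"
  unfolding UNIV_4 by (simp add: ac_simps)

lemma vector_4 [simp]:
  "(vector [a, b, c, d] :: ('a::zero)^4)$1 = a"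
  "(vector [a, b, c, d] :: ('a::zero)^4)$2 = b"
  "(vector [a, b, c, d] :: ('a::zero)^4)$3 = c"
  "(vector [a, b, c, d] :: ('a::zero)^4)$4 = d"
  unfolding vector_def by simp_all

lemma vector_5 [simp]:
  "(vector [a, b, c, d, e] :: ('a::zero)^5)$1 = a"
  "(vector [a, b, c, d, e] :: ('a::zero)^5)$2 = b"
  "(vector [a, b, c, d, e] :: ('a::zero)^5)$3 = c"
  "(vector [a, b, c, d, e] :: ('a::zero)^5)$4 = d"
  "(vector [a, b, c, d, e] :: ('a::zero)^5)$5 = e"
  unfolding vector_def by simp_all

text \<open>The Euclidean sphere with centre \<open>c\<close> and radius \<open>r\<close>.\<close>

lemma sphere_of_euclidean:
  fixes c :: "real^3"
  assumes r: "r > 0" and s: "\<bar>s\<bar> = 1"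
  defines "x \<equiv> (s / r) *\<^sub>R
    (vector [c$1, c$2, c$3, ((norm c)\<^sup>2 - r\<^sup>2 - 1) / 2, ((norm c)\<^sup>2 - r\<^sup>2 + 1) / 2] :: real^5)"
  shows "x \<in> oriented_spheres" "sphere_of x = Some ` sphere c r"
proof -
  have n: "(norm p)\<^sup>2 = (p$1)\<^sup>2 + (p$2)\<^sup>2 + (p$3)\<^sup>2" for p :: "real^3"
    unfolding power2_norm_eq_inner by (simp add: inner_vec_def sum_3 power2_eq_square)
  have s2: "s\<^sup>2 = 1" using s by (simp add: abs_square_eq_1)
  show "x \<in> oriented_spheres"
  proof -
    have gen: "lorentz (k *\<^sub>R vector [a, b, d, e, f]) (k *\<^sub>R vector [a, b, d, e, f])
        = k\<^sup>2 * (a\<^sup>2 + b\<^sup>2 + d\<^sup>2 + e\<^sup>2 - f\<^sup>2)" for k a b d e f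
      by (simp add: lorentz_def algebra_simps power2_eq_square)
    have "lorentz x x = (s/r)\<^sup>2 * ((norm c)\<^sup>2 + (((norm c)\<^sup>2 - r\<^sup>2 - 1) / 2)\<^sup>2 - (((norm c)\<^sup>2 - r\<^sup>2 + 1) / 2)\<^sup>2)"
      unfolding x_def gen by (simp only: n)
    also have "\<dots> = (s/r)\<^sup>2 * r\<^sup>2" by (simp add: field_simps power2_eq_square)
    also have "\<dots> = 1" using r s2 by (simp add: power_divide)
    finally show ?thesis by (simp add: oriented_spheres_def)
  qed
  have inf: "sphere_fun x (stereo None) = - (s / r)"
    using r by (simp add: sphere_fun_def lorentz_def x_def divide_simps) (simp add: algebra_simps)
  have fin: "sphere_fun x (stereo (Some p)) =
     (s / r) / ((norm p)\<^sup>2 + 1) * (r\<^sup>2 - (norm (p - c))\<^sup>2)" for p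
  proof -
    have pos: "(norm p)\<^sup>2 + 1 \<noteq> 0" by (smt (verit) zero_le_power2)
    have "sphere_fun x (stereo (Some p)) * ((norm p)\<^sup>2 + 1) =
      (s / r) * (2 * (c$1 * p$1 + c$2 * p$2 + c$3*p$3) +
       ((norm c)\<^sup>2 - r\<^sup>2 - 1) / 2 * ((norm p)\<^sup>2 - 1) - ((norm c)\<^sup>2 - r\<^sup>2 + 1) / 2 * ((norm p)\<^sup>2 + 1))"
      using pos by (simp add: sphere_fun_def lorentz_def x_def divide_simps) (simp add: algebra_simps)
    also have "\<dots> = (s / r) * (r\<^sup>2 - (norm (p - c))\<^sup>2)"
      unfolding n by (simp add: algebra_simps power2_eq_square diff_divide_distrib add_divide_distrib)
    finally show ?thesis
      using pos by (metis nonzero_eq_divide_eq times_divide_eq_left)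
  qed
  have "sphere_fun x (stereo z) = 0 \<longleftrightarrow> z \<in> Some ` sphere c r" for z
  proof (cases z)
    case None
    then show ?thesis using r s inf by auto
  next
    case (Some p)
    have pos: "(norm p)\<^sup>2 + 1 \<noteq> 0" by (smt (verit) zero_le_power2)
    have "sphere_fun x (stereo z) = 0 \<longleftrightarrow> r\<^sup>2 = (norm (p - c))\<^sup>2"
      using r s pos unfolding Some fin by auto
    also have "\<dots> \<longleftrightarrow> r = norm (p - c)" using r by (simp add: power2_eq_iff_nonneg)
    also have "\<dots> \<longleftrightarrow> z \<in> Some ` sphere c r" by (auto simp: Some dist_norm norm_minus_commute)
    finally show ?thesis .
  qed
  then show "sphere_of x = Some ` sphere c r"
    unfolding sphere_of_def by blast
qed


section \<open>Existence and uniqueness of the measure\<close>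

text \<open>Existence: the measure of \<open>A\<close> is five times the volume of the cone over \<open>A\<close> with apex \<open>0\<close>.\<close>

lemma nn_measure_image:
  fixes f :: "real^'n::{finite,wellorder} \<Rightarrow> real^'n::_"
  assumes S: "S \<in> sets borel"
    and d: "\<And>x. x \<in> S \<Longrightarrow> (f has_derivative f' x) (at x)"
    and inj: "inj_on f S"
    and m: "(\<lambda>x. indicator S x * \<bar>det (matrix (f' x))\<bar>) \<in> borel_measurable borel"
  shows "emeasure lebesgue (f ` S) = (\<integral>\<^sup>+x\<in>S. ennreal \<bar>det (matrix (f' x))\<bar> \<partial>lborel)"
proof -
  define J where "J x = indicator S x * \<bar>det (matrix (f' x))\<bar>" for x
  have [measurable]: "J \<in> borel_measurable borel" using m by (simp add: J_def[abs_def])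
  note [measurable] = S
  define T where "T n = {x\<in>S. norm x \<le> real n \<and> J x \<le> real n}" for n
  have T[measurable]: "T n \<in> sets borel" for n unfolding T_def by measurable
  have Tsub: "T n \<subseteq> S" for n by (auto simp: T_def)
  have incT: "incseq T" by (auto simp: T_def incseq_def intro: order_trans)
  have UT: "(\<Union>n. T n) = S"
  proof -
    have "\<exists>n. norm x \<le> real n \<and> J x \<le> real n" for x
      by (meson real_arch_simple max.bounded_iff)
    then show ?thesis by (auto simp: T_def)
  qed
  have J0: "J x \<ge> 0" for x by (simp add: J_def)
  have step: "f ` T n \<in> sets lebesgue \<and> emeasure lebesgue (f ` T n) = (\<integral>\<^sup>+x\<in>T n. ennreal (J x) \<partial>lborel)" for n
  proof -
    have fin: "emeasure lborel (T n) < \<infinity>"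
    proof -
      have "emeasure lborel (T n) \<le> emeasure lborel (cball (0::real^'n::{finite,wellorder}) (real n))"
        by (rule emeasure_mono) (auto simp: T_def)
      also have "\<dots> < \<infinity>" by (rule emeasure_bounded_finite) simp
      finally show ?thesis .
    qed
    have si: "set_integrable lborel (T n) J"
      unfolding set_integrable_def
    proof (rule integrableI_bounded_set[where A = "T n" and B = "real n"])
      show "AE x in lborel. x \<in> T n \<longrightarrow> norm (indicator (T n) x *\<^sub>R J x) \<le> real n"
        by (auto simp: T_def J0)
    qed (use fin in auto)
    have eqJ: "x \<in> T n \<Longrightarrow> \<bar>det (matrix (f' x))\<bar> = J x" for x using subsetD[OF Tsub[of n]] by (simp add: J_def)
    have "(J has_integral (LINT x:T n|lborel. J x)) (T n)"
      using set_borel_integral_eq_integral[OF si] by (simp add: has_integral_iff)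
    then have hi: "((\<lambda>x. \<bar>det (matrix (f' x))\<bar>) has_integral (LINT x:T n|lborel. J x)) (T n)"
      using eqJ by (subst has_integral_cong) auto
    have "f ` T n \<in> lmeasurable \<and> measure lebesgue (f ` T n) = (LINT x:T n|lborel. J x)"
      using hi
      by (subst has_measure_differentiable_image[where f' = f'])
         (use T d Tsub inj in \<open>auto intro: has_derivative_at_withinI inj_on_subset\<close>)
    then have l: "f ` T n \<in> lmeasurable" and me: "measure lebesgue (f ` T n) = (LINT x:T n|lborel. J x)" by auto
    have "emeasure lebesgue (f ` T n) = ennreal (LINT x:T n|lborel. J x)"
      using emeasure_eq_measure2[OF l] by (simp only: me)
    also have "\<dots> = (\<integral>\<^sup>+x. ennreal (indicator (T n) x *\<^sub>R J x) \<partial>lborel)"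
      unfolding set_lebesgue_integral_def
      using si J0 by (intro nn_integral_eq_integral[symmetric]) (auto simp: set_integrable_def)
    also have "\<dots> = (\<integral>\<^sup>+x\<in>T n. ennreal (J x) \<partial>lborel)"
      by (intro nn_integral_cong) (auto simp: indicator_def)
    finally show ?thesis using l by auto
  qed
  have "emeasure lebesgue (f ` S) = emeasure lebesgue (\<Union>n. f ` T n)"
    by (simp add: UT[symmetric] image_UN)
  also have "\<dots> = (SUP n. emeasure lebesgue (f ` T n))"
  proof (rule SUP_emeasure_incseq[symmetric])
    show "range (\<lambda>n. f ` T n) \<subseteq> sets lebesgue" using step by blast
    show "incseq (\<lambda>n. f ` T n)" using incT unfolding incseq_def by (meson image_mono)
  qed
  also have "\<dots> = (SUP n. \<integral>\<^sup>+x\<in>T n. ennreal (J x) \<partial>lborel)" using step by simp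
  also have "\<dots> = (SUP n. emeasure (density lborel (\<lambda>x. ennreal (J x))) (T n))"
    by (simp add: emeasure_density)
  also have "\<dots> = emeasure (density lborel (\<lambda>x. ennreal (J x))) (\<Union>n. T n)"
    using incT T by (intro SUP_emeasure_incseq) auto
  also have "\<dots> = (\<integral>\<^sup>+x\<in>S. ennreal (J x) \<partial>lborel)"
    unfolding UT by (simp add: emeasure_density)
  also have "\<dots> = (\<integral>\<^sup>+x\<in>S. ennreal \<bar>det (matrix (f' x))\<bar> \<partial>lborel)"
    by (intro nn_integral_cong) (auto simp: J_def indicator_def)
  finally show ?thesis .
qed

definition drop5 :: "real^5 \<Rightarrow> real^4" where
  "drop5 w = vector [w$1, w$2, w$3, w$4]"

lemma linear_drop5: "linear drop5"
  by (rule linearI) (simp_all add: drop5_def vec_eq_iff forall_4)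

lemma bounded_linear_drop5: "bounded_linear drop5"
  using linear_drop5 by (simp add: linear_conv_bounded_linear)

definition snoc4 :: "(real^4) \<times> real \<Rightarrow> real^5" where
  "snoc4 p = vector [fst p$1, fst p$2, fst p$3, fst p$4, snd p]"

lemma linear_snoc4: "linear snoc4"
  by (rule linearI) (simp_all add: snoc4_def vec_eq_iff forall_5)

lemma borel_snoc4 [measurable]: "snoc4 \<in> borel_measurable borel"
  by (intro borel_measurable_continuous_onI linear_continuous_on)
     (use linear_snoc4 in \<open>simp add: linear_conv_bounded_linear\<close>)

lemma borel_drop5 [measurable]: "drop5 \<in> borel_measurable borel"
  by (intro borel_measurable_continuous_onI linear_continuous_on bounded_linear_drop5)

lemma snoc4_simps [simp]: "drop5 (snoc4 (u, t)) = u" "snoc4 (u, t) $ 5 = t"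
  by (simp_all add: drop5_def snoc4_def vec_eq_iff forall_4)

lemma lborel_snoc4: "lborel = distr (lborel \<Otimes>\<^sub>M lborel) borel snoc4"
proof (rule lborel_eqI)
  fix l u :: "real^5" assume le: "\<And>b. b \<in> Basis \<Longrightarrow> l \<bullet> b \<le> u \<bullet> b"
  have le': "l $ i \<le> u $ i" for i using le[of "axis i 1"] by (auto simp: inner_axis axis_in_Basis_iff)
  have "snoc4 -` box l u = box (drop5 l) (drop5 u) \<times> box (l$5) (u$5)"
    by (auto simp: mem_box_cart forall_4 forall_5 snoc4_def drop5_def)
  then have "emeasure (distr (lborel \<Otimes>\<^sub>M lborel) borel snoc4) (box l u)
     = emeasure (lborel \<Otimes>\<^sub>M lborel) (box (drop5 l) (drop5 u) \<times> box (l$5) (u$5))"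
    by (subst emeasure_distr) (auto simp: space_pair_measure lborel_prod)
  also have "\<dots> = emeasure lborel (box (drop5 l) (drop5 u)) * emeasure lborel (box (l$5) (u$5))"
    by (rule lborel.emeasure_pair_measure_Times) auto
  also have "emeasure lborel (box (drop5 l) (drop5 u)) = ennreal (\<Prod>i\<in>UNIV. drop5 u $ i - drop5 l $ i)"
  proof -
    have "emeasure lborel (box (drop5 l) (drop5 u)) = (\<Prod>b\<in>Basis. (drop5 u - drop5 l) \<bullet> b)"
    proof (rule emeasure_lborel_box)
      have "drop5 l $ i \<le> drop5 u $ i" for i
        using exhaust_4[of i] by (auto simp: drop5_def le')
      then show "drop5 l \<bullet> b \<le> drop5 u \<bullet> b" if "b \<in> Basis" for b
        using that by (auto simp: Basis_vec_def inner_axis)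
    qed
    also have "(\<Prod>b\<in>Basis. (drop5 u - drop5 l) \<bullet> b) = (\<Prod>i\<in>UNIV. drop5 u $ i - drop5 l $ i)"
      unfolding Basis_vec_def
      by (auto simp: prod.UNION_disjoint axis_eq_axis inner_axis)
    finally show ?thesis .
  qed
  also have "emeasure lborel (box (l$5) (u$5)) = ennreal (u$5 - l$5)"
    using le' by (simp add: box_real)
  also have "ennreal (\<Prod>i\<in>UNIV. drop5 u $ i - drop5 l $ i) * ennreal (u$5 - l$5) = ennreal (\<Prod>i\<in>UNIV. u$i - l$i)"
    using le' by (subst ennreal_mult[symmetric])
      (auto simp: prod_4 prod_5 drop5_def mult_ac intro!: mult_nonneg_nonneg)
  also have "(\<Prod>i\<in>UNIV. u$i - l$i) = (\<Prod>b\<in>Basis. (u - l) \<bullet> b)"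
    unfolding Basis_vec_def
    by (auto simp: prod.UNION_disjoint axis_eq_axis inner_axis)
  finally show "emeasure (distr (lborel \<Otimes>\<^sub>M lborel) borel snoc4) (box l u) = ennreal (\<Prod>b\<in>Basis. (u - l) \<bullet> b)" .
qed simp

lemma nn_integral_snoc4:
  assumes g [measurable]: "g \<in> borel_measurable borel"
  shows "(\<integral>\<^sup>+w. (ennreal (w$5^4) * indicator {0<..<1} (w$5)) * g (drop5 w) \<partial>lborel) = ennreal (1/5) * (\<integral>\<^sup>+u. g u \<partial>lborel)"
proof -
  have [measurable]: "(\<lambda>w::real^5. w $ 5) \<in> borel_measurable borel"
    by (intro borel_measurable_continuous_onI continuous_intros)
  have "(\<integral>\<^sup>+w. (ennreal (w$5^4) * indicator {0<..<1} (w$5)) * g (drop5 w) \<partial>lborel)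
      = (\<integral>\<^sup>+p. (ennreal (snoc4 p$5^4) * indicator {0<..<1} (snoc4 p$5)) * g (drop5 (snoc4 p)) \<partial>(lborel \<Otimes>\<^sub>M lborel))"
    by (subst lborel_snoc4, subst nn_integral_distr) (auto simp: lborel_prod)
  also have "\<dots> = (\<integral>\<^sup>+u. \<integral>\<^sup>+t. (ennreal (t^4) * indicator {0<..<1} t) * g u \<partial>lborel \<partial>lborel)"
    by (subst lborel.nn_integral_fst[symmetric]) (auto simp: lborel_prod)
  also have "\<dots> = (\<integral>\<^sup>+u. (\<integral>\<^sup>+t. ennreal (t^4) * indicator {0<..<1} t \<partial>lborel) * g u \<partial>lborel)"
    by (intro nn_integral_cong nn_integral_multc) auto
  also have "(\<integral>\<^sup>+t. ennreal (t^4) * indicator {0<..<1} t \<partial>lborel) = (\<integral>\<^sup>+t. ennreal (t^4) * indicator {0..1::real} t \<partial>lborel)"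
    by (intro nn_integral_cong_AE AE_I'[of "{0,1}"]) (auto simp: indicator_def finite_imp_null_set_lborel)
  also have "\<dots> = ennreal (1^5/5 - 0^5/5)"
    by (intro nn_integral_FTC_Icc) (auto intro!: derivative_eq_intros)
  also have "(\<integral>\<^sup>+u. ennreal (1^5/5 - 0^5/5) * g u \<partial>lborel) = ennreal (1/5) * (\<integral>\<^sup>+u. g u \<partial>lborel)"
    by (subst nn_integral_cmult) auto
  finally show ?thesis .
qed

lemma continuous_on_iota_vol:
  assumes "continuous_on U x" "\<And>i. continuous_on U (\<lambda>u. v u i)"
  shows "continuous_on U (\<lambda>u. iota_vol (x u) (v u))"
proof -
  have *: "continuous_on U (\<lambda>u. (vector [x u, v u 1, v u 2, v u 3, v u 4] :: real^5^5) $ i)" for i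
    using exhaust_5[of i] assms by auto
  show ?thesis unfolding iota_vol_def det_def
    by (intro continuous_intros *)
qed

lemma det_cone:
  fixes L :: "real^4 \<Rightarrow> real^5"
  assumes "linear L"
  shows "\<bar>det (matrix (\<lambda>h. h$5 *\<^sub>R x + t *\<^sub>R L (drop5 h)))\<bar> = t^4 * \<bar>iota_vol x (\<lambda>i. L (axis i 1))\<bar>"
proof -
  define G where "G h = h$5 *\<^sub>R x + t *\<^sub>R L (drop5 h)" for h
  define A :: "real^5^5" where "A = vector [x, L (axis 1 1), L (axis 2 1), L (axis 3 1), L (axis 4 1)]"
  define A' :: "real^5^5" where "A' = (\<chi> i. (if i = 1 then 1 else t) *s A $ i)"
  have d: "drop5 (axis 1 1) = axis 1 1" "drop5 (axis 2 1) = axis 2 1" "drop5 (axis 3 1) = axis 3 1"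
     "drop5 (axis 4 1) = axis 4 1" "drop5 (axis 5 1) = 0"
    by (simp_all add: drop5_def vec_eq_iff forall_4 axis_def)
  have L0: "L 0 = 0" using assms by (rule linear_0)
  have a5: "(axis 1 1 :: real^5) $ 5 = 0" "(axis 2 1 :: real^5) $ 5 = 0" "(axis 3 1 :: real^5) $ 5 = 0"
     "(axis 4 1 :: real^5) $ 5 = 0" "(axis 5 1 :: real^5) $ 5 = 1"
    by (simp_all add: axis_def)
  have G: "G (axis 1 1) = t *\<^sub>R L (axis 1 1)" "G (axis 2 1) = t *\<^sub>R L (axis 2 1)"
    "G (axis 3 1) = t *\<^sub>R L (axis 3 1)" "G (axis 4 1) = t *\<^sub>R L (axis 4 1)" "G (axis 5 1) = x"
    by (simp_all only: G_def d L0 a5) simp_all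
  have s5: "(5::5) + 1 = 1" "(1::5) + 1 = 2" "(2::5) + 1 = 3" "(3::5) + 1 = 4" "(4::5) + 1 = 5" by simp_all
  have rows: "A' $ (j + 1) = G (axis j 1)" for j
    using exhaust_5[of j]
    by (elim disjE; hypsubst; unfold s5 G) (simp_all add: A'_def A_def scalar_mult_eq_scaleR)
  have "transpose (matrix G) = (\<chi> i. A' $ (i + 1))"
    by (simp add: vec_eq_iff transpose_def matrix_def rows)
  moreover have "(\<lambda>i::5. i + 1) permutes UNIV"
    by (rule bij_imp_permutes) (auto intro!: bijI injI surjI[of _ "\<lambda>i. i - 1"])
  ultimately have "\<bar>det (matrix G)\<bar> = \<bar>det A'\<bar>"
    using det_permute_rows[of "\<lambda>i. i + 1" A'] det_transpose[of "matrix G"]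
    by (cases "evenperm (\<lambda>i::5. i + 1)") (auto simp: sign_def)
  also have "det A' = t^4 * det A"
    unfolding A'_def det_rows_mul by (simp add: prod_5 power4_eq_xxxx)
  finally show ?thesis
    unfolding G_def[abs_def] A_def iota_vol_def by (simp add: abs_mult)
qed

lemma lorentz_scaleR: "lorentz (k *\<^sub>R x) (k *\<^sub>R y) = k\<^sup>2 * lorentz x y"
  by (simp add: lorentz_def algebra_simps power2_eq_square)

lemma continuous_on_lorentz: "continuous_on UNIV (\<lambda>x. lorentz x x)"
  unfolding lorentz_def by (intro continuous_intros)

lemma borel_lorentz [measurable]: "(\<lambda>x. lorentz x x) \<in> borel_measurable borel"
  by (intro borel_measurable_continuous_onI continuous_on_lorentz)

lemma closed_oriented_spheres: "closed oriented_spheres"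
  unfolding oriented_spheres_def
  by (intro closed_Collect_eq continuous_on_lorentz continuous_intros)

lemma sets_oriented_spheres [measurable]: "oriented_spheres \<in> sets borel"
  by (intro borel_closed closed_oriented_spheres)

lemma sphere_measure_exists: "\<exists>M. is_sphere_measure M"
proof -
  define C where "C = {y :: real^5. 0 < lorentz y y \<and> lorentz y y < 1}"
  define \<rho> where "\<rho> y = (1 / sqrt (lorentz y y)) *\<^sub>R y" for y :: "real^5"
  define M0 where "M0 = restrict_space (scale_measure 5 lborel) C"
  define M where "M = distr M0 (restrict_space borel oriented_spheres) \<rho>"
  have C [measurable]: "C \<in> sets borel" unfolding C_def by measurable
  have \<rho> [measurable]: "\<rho> \<in> borel_measurable borel" unfolding \<rho>_def by measurable
  have spM0: "space M0 = C" by (simp add: M0_def space_restrict_space)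
  have setsM0: "sets M0 = sets (restrict_space borel C)"
    unfolding M0_def by (intro sets_restrict_space_cong) simp
  have \<rho>C: "\<rho> y \<in> oriented_spheres" if "y \<in> C" for y
    using that by (simp add: \<rho>_def C_def oriented_spheres_def lorentz_scaleR power_divide)
  have \<rho>m: "\<rho> \<in> measurable M0 (restrict_space borel oriented_spheres)"
    by (subst measurable_cong_sets[OF setsM0 refl], rule measurable_restrict_space2)
       (auto simp: space_restrict_space \<rho>C intro: measurable_restrict_space1)
  have emM: "emeasure M A = 5 * emeasure lborel {y\<in>C. \<rho> y \<in> A}"
    if A: "A \<in> sets borel" "A \<subseteq> oriented_spheres" for A
  proof -
    have "A \<in> sets (restrict_space borel oriented_spheres)"
      using A by (subst sets_restrict_space_iff) auto
    then have "emeasure M A = emeasure M0 (\<rho> -` A \<inter> C)"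
      unfolding M_def using \<rho>m by (subst emeasure_distr) (auto simp: spM0)
    also have "\<rho> -` A \<inter> C = {y\<in>C. \<rho> y \<in> A}" by auto
    also have "emeasure M0 {y\<in>C. \<rho> y \<in> A} = 5 * emeasure lborel {y\<in>C. \<rho> y \<in> A}"
      unfolding M0_def by (subst emeasure_restrict_space) auto
    finally show ?thesis .
  qed
  have "emeasure M A =
      (\<integral>\<^sup>+ u \<in> {u\<in>U. \<phi> u \<in> A}. ennreal \<bar>iota_vol (\<phi> u) (\<lambda>i. \<phi>' u (axis i 1))\<bar> \<partial>lborel)"
    if p: "C1_param U \<phi> \<phi>'" and A [measurable]: "A \<in> sets borel" and AU: "A \<subseteq> \<phi> ` U" for U \<phi> \<phi>' A
  proof -
    define B where "B = {u\<in>U. \<phi> u \<in> A}"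
    define g where "g u = \<bar>iota_vol (\<phi> u) (\<lambda>i. \<phi>' u (axis i 1))\<bar>" for u
    define S where "S = {w :: real^5. 0 < w$5 \<and> w$5 < 1 \<and> drop5 w \<in> B}"
    define F where "F w = w$5 *\<^sub>R \<phi> (drop5 w)" for w :: "real^5"
    define F' where "F' w h = h$5 *\<^sub>R \<phi> (drop5 w) + w$5 *\<^sub>R \<phi>' (drop5 w) (drop5 h)" for w h :: "real^5"
    have U: "open U" "\<phi> ` U \<subseteq> oriented_spheres" "inj_on \<phi> U"
      and d: "\<And>u. u \<in> U \<Longrightarrow> (\<phi> has_derivative \<phi>' u) (at u)"
      and c: "\<And>v. continuous_on U (\<lambda>u. \<phi>' u v)"
      using p by (auto simp: C1_param_def)
    have [measurable]: "U \<in> sets borel" using U(1) by (rule borel_open)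
    have c\<phi>: "continuous_on U \<phi>"
      using d by (intro continuous_at_imp_continuous_on ballI) (blast intro: has_derivative_continuous)
    have \<phi>m: "\<phi> \<in> measurable (restrict_space borel U) borel"
      by (rule borel_measurable_continuous_on_restrict[OF c\<phi>])
    have B [measurable]: "B \<in> sets borel"
    proof -
      have "\<phi> -` A \<inter> space (restrict_space borel U) \<in> sets (restrict_space borel U)"
        by (rule measurable_sets[OF \<phi>m A])
      moreover have "\<phi> -` A \<inter> space (restrict_space borel U) = B"
        by (auto simp: space_restrict_space B_def)
      ultimately show ?thesis by (auto simp: sets_restrict_space_iff)
    qed
    have "continuous_on U g"
      unfolding g_def by (intro continuous_intros continuous_on_iota_vol c\<phi> c)
    then have "(\<lambda>u. indicator U u *\<^sub>R g u) \<in> borel_measurable borel"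
      by (intro borel_measurable_continuous_on_indicator) auto
    then have "(\<lambda>u. indicator B u * (indicator U u *\<^sub>R g u)) \<in> borel_measurable borel"
      by measurable
    moreover have "(\<lambda>u. indicator B u * (indicator U u *\<^sub>R g u)) = (\<lambda>u. indicator B u * g u)"
      by (auto simp: indicator_def B_def)
    ultimately have gm [measurable]: "(\<lambda>u. indicator B u * g u) \<in> borel_measurable borel" by simp
    have [measurable]: "(\<lambda>w::real^5. w $ 5) \<in> borel_measurable borel"
      by (intro borel_measurable_continuous_onI continuous_intros)
    have S [measurable]: "S \<in> sets borel" unfolding S_def by measurable
    have L1: "lorentz (\<phi> u) (\<phi> u) = 1" if "u \<in> U" for u
      using U that by (auto simp: oriented_spheres_def)
    have SU: "drop5 w \<in> U" if "w \<in> S" for w using that by (auto simp: S_def B_def)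
    have LF: "lorentz (F w) (F w) = (w$5)\<^sup>2" if "w \<in> S" for w
      using L1[OF SU[OF that]] by (simp add: F_def lorentz_scaleR)
    have \<rho>F: "\<rho> (F w) = \<phi> (drop5 w)" if "w \<in> S" for w
      using that unfolding \<rho>_def LF[OF that] by (auto simp: S_def F_def)
    have eq5: "w = w'" if "drop5 w = drop5 w'" "w $ 5 = w' $ 5" for w w'
      using that by (auto simp: drop5_def vec_eq_iff forall_4 forall_5)
    have inj: "inj_on F S"
    proof (rule inj_onI)
      fix w w' assume w: "w \<in> S" "w' \<in> S" "F w = F w'"
      then have "(w$5)\<^sup>2 = (w'$5)\<^sup>2" using LF by metis
      then have "w$5 = w'$5" using w by (auto simp: S_def power2_eq_iff_nonneg)
      moreover have "\<phi> (drop5 w) = \<phi> (drop5 w')" using w \<rho>F by metis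
      then have "drop5 w = drop5 w'" using U SU w by (meson inj_onD)
      ultimately show "w = w'" using eq5 by blast
    qed
    have im: "F ` S = {y\<in>C. \<rho> y \<in> A}"
    proof (intro equalityI subsetI)
      fix y assume "y \<in> F ` S"
      then obtain w where w: "w \<in> S" "y = F w" by blast
      have "(w$5)\<^sup>2 < 1" using w by (simp add: S_def power_less_one_iff abs_square_less_1)
      then show "y \<in> {y\<in>C. \<rho> y \<in> A}" using w \<rho>F LF by (auto simp: C_def S_def B_def)
    next
      fix y assume y: "y \<in> {y\<in>C. \<rho> y \<in> A}"
      then obtain u where u: "u \<in> U" "\<rho> y = \<phi> u" using AU by blast
      define w where "w = snoc4 (u, sqrt (lorentz y y))"
      have pos: "0 < lorentz y y" "lorentz y y < 1" using y by (auto simp: C_def)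
      have "w \<in> S" using u y pos by (auto simp: w_def S_def B_def)
      moreover have "F w = y"
        using pos by (simp add: F_def w_def u(2)[symmetric] \<rho>_def)
      ultimately show "y \<in> F ` S" by blast
    qed
    have dF: "(F has_derivative F' w) (at w)" if "w \<in> S" for w
    proof -
      have "(drop5 has_derivative drop5) (at w)"
        using bounded_linear_drop5 by (rule bounded_linear_imp_has_derivative)
      moreover have "(\<phi> has_derivative \<phi>' (drop5 w)) (at (drop5 w))" using d SU[OF that] .
      ultimately have "((\<lambda>w. \<phi> (drop5 w)) has_derivative (\<lambda>h. \<phi>' (drop5 w) (drop5 h))) (at w)"
        by (rule has_derivative_compose)
      moreover have "((\<lambda>w::real^5. w $ 5) has_derivative (\<lambda>h. h $ 5)) (at w)"
        by (intro bounded_linear_imp_has_derivative bounded_linear_vec_nth)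
      ultimately show ?thesis
        unfolding F_def[abs_def] F'_def[abs_def]
        by (auto intro!: derivative_eq_intros simp: add.commute)
    qed
    have det: "\<bar>det (matrix (F' w))\<bar> = (w$5)^4 * g (drop5 w)" if "w \<in> S" for w
      unfolding F'_def[abs_def] g_def
      using d[OF SU[OF that]] by (intro det_cone) (simp add: has_derivative_linear)
    have m: "(\<lambda>w. indicator S w * \<bar>det (matrix (F' w))\<bar>) \<in> borel_measurable borel"
    proof -
      have "(\<lambda>w. indicator S w * \<bar>det (matrix (F' w))\<bar>)
        = (\<lambda>w. indicator S w * ((w$5)^4 * (indicator B (drop5 w) * g (drop5 w))))"
        using det by (auto simp: indicator_def S_def)
      also have "\<dots> \<in> borel_measurable borel" by measurable
      finally show ?thesis .
    qed
    have "emeasure M A = 5 * emeasure lborel (F ` S)"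
      using emM[OF A] AU U im by auto
    also have "emeasure lborel (F ` S) = emeasure lebesgue (F ` S)"
      unfolding im by simp
    also have "\<dots> = (\<integral>\<^sup>+w\<in>S. ennreal \<bar>det (matrix (F' w))\<bar> \<partial>lborel)"
      by (rule nn_measure_image[OF S dF inj m])
    also have "\<dots> = (\<integral>\<^sup>+w. (ennreal (w$5^4) * indicator {0<..<1} (w$5)) *
         ennreal (indicator B (drop5 w) * g (drop5 w)) \<partial>lborel)"
      by (intro nn_integral_cong)
         (auto simp: indicator_def det, auto simp: S_def ennreal_mult g_def)
    also have "\<dots> = ennreal (1/5) * (\<integral>\<^sup>+u. ennreal (indicator B u * g u) \<partial>lborel)"
      by (subst nn_integral_snoc4) auto
    also have "5 * \<dots> = (ennreal 5 * ennreal (1/5)) * (\<integral>\<^sup>+u. ennreal (indicator B u * g u) \<partial>lborel)"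
      by (simp add: mult.assoc)
    also have "ennreal 5 * ennreal (1/5) = 1"
      by (subst ennreal_mult[symmetric]) auto
    also have "1 * (\<integral>\<^sup>+u. ennreal (indicator B u * g u) \<partial>lborel) = (\<integral>\<^sup>+u\<in>B. ennreal (g u) \<partial>lborel)"
      by (simp, intro nn_integral_cong) (auto simp: indicator_def)
    finally show ?thesis by (simp add: B_def g_def)
  qed
  moreover have "sets M = sets (restrict_space borel oriented_spheres)" by (simp add: M_def)
  ultimately have "is_sphere_measure M" by (simp add: is_sphere_measure_def)
  then show ?thesis ..
qed

text \<open>Stereographic projection of the quadric from the points \<open>\<mp>e\<^sub>1\<close>.\<close>

definition quad4 :: "real^4 \<Rightarrow> real" where
  "quad4 u = u$1 * u$1 + u$2 * u$2 + u$3 * u$3 - u$4 * u$4"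

definition quad4' :: "real^4 \<Rightarrow> real^4 \<Rightarrow> real" where
  "quad4' u v = 2 * (u$1 * v$1 + u$2 * v$2 + u$3 * v$3 - u$4 * v$4)"

definition emb4 :: "real^4 \<Rightarrow> real^5" where
  "emb4 u = vector [0, u$1, u$2, u$3, u$4]"

definition chart :: "real \<Rightarrow> real^4 \<Rightarrow> real^5" where
  "chart s u = (1 / (1 + quad4 u)) *\<^sub>R (((1 - quad4 u) * s) *\<^sub>R axis 1 1 + 2 *\<^sub>R emb4 u)"

definition chart' :: "real \<Rightarrow> real^4 \<Rightarrow> real^4 \<Rightarrow> real^5" where
  "chart' s u v = (- quad4' u v / (1 + quad4 u)\<^sup>2) *\<^sub>R (((1 - quad4 u) * s) *\<^sub>R axis 1 1 + 2 *\<^sub>R emb4 u)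
     + (1 / (1 + quad4 u)) *\<^sub>R ((- (quad4' u v) * s) *\<^sub>R axis 1 1 + 2 *\<^sub>R emb4 v)"

definition unchart :: "real \<Rightarrow> real^5 \<Rightarrow> real^4" where
  "unchart s x = (1 / (1 + s * x$1)) *\<^sub>R vector [x$2, x$3, x$4, x$5]"

lemma linear_emb4: "linear emb4"
  by (rule linearI) (simp_all add: emb4_def vec_eq_iff forall_5)

lemma chart_nth:
  "chart s u $ 1 = s * (1 - quad4 u) / (1 + quad4 u)"
  "chart s u $ 2 = 2 * u$1 / (1 + quad4 u)" "chart s u $ 3 = 2 * u$2 / (1 + quad4 u)"
  "chart s u $ 4 = 2 * u$3 / (1 + quad4 u)" "chart s u $ 5 = 2 * u$4 / (1 + quad4 u)"
  by (simp_all add: chart_def emb4_def axis_def)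

lemma unchart_chart:
  assumes "s * s = 1" "1 + quad4 u \<noteq> 0"
  shows "unchart s (chart s u) = u"
proof -
  have "1 + s * chart s u $ 1 = 2 / (1 + quad4 u)"
    using assms by (simp add: chart_nth mult.assoc[symmetric] field_simps)
  then show ?thesis using assms
    by (simp add: unchart_def vec_eq_iff forall_4 chart_nth)
qed

lemma chart_on_quadric:
  assumes "s * s = 1" "1 + quad4 u \<noteq> 0"
  shows "chart s u \<in> oriented_spheres"
proof -
  have "lorentz (chart s u) (chart s u) =
     ((s * s) * (1 - quad4 u)\<^sup>2 + 4 * quad4 u) / (1 + quad4 u)\<^sup>2"
    unfolding lorentz_def chart_nth
    by (simp add: quad4_def add_divide_distrib diff_divide_distrib power2_eq_square algebra_simps)
  also have "\<dots> = (1 + quad4 u)\<^sup>2 / (1 + quad4 u)\<^sup>2"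
    using assms by (simp add: power2_eq_square algebra_simps)
  also have "\<dots> = 1" using assms by simp
  finally show ?thesis by (simp add: oriented_spheres_def)
qed

lemma chart_unchart:
  assumes s: "s * s = 1" and x: "x \<in> oriented_spheres" and n: "1 + s * x$1 \<noteq> 0"
  shows "1 + quad4 (unchart s x) \<noteq> 0" "chart s (unchart s x) = x"
proof -
  let ?k = "1 + s * x$1"
  have L: "x$2 * x$2 + x$3 * x$3 + x$4 * x$4 - x$5 * x$5 = 1 - x$1 * x$1"
    using x by (simp add: oriented_spheres_def lorentz_def)
  have "quad4 (unchart s x) = (1 - x$1 * x$1) / (?k * ?k)"
    unfolding L[symmetric] by (simp add: quad4_def unchart_def add_divide_distrib diff_divide_distrib)
  also have "1 - x$1 * x$1 = (1 - s * x$1) * ?k"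
    using s by (simp add: algebra_simps)
  finally have q: "quad4 (unchart s x) = (1 - s * x$1) / ?k" using n by simp
  then have q1: "1 + quad4 (unchart s x) = 2 / ?k" using n by (simp add: field_simps)
  then show "1 + quad4 (unchart s x) \<noteq> 0" using n by simp
  have "1 - quad4 (unchart s x) = 2 * s * x$1 / ?k" using n unfolding q by (simp add: field_simps)
  then have "chart s (unchart s x) $ 1 = s * s * x$1"
    using n by (simp add: chart_nth q1)
  moreover have "chart s (unchart s x) $ i = x $ i" if "i \<in> {2,3,4,5}" for i
    using that n by (auto simp: chart_nth q1) (auto simp: unchart_def)
  ultimately show "chart s (unchart s x) = x"
    using s by (simp add: vec_eq_iff forall_5)
qed

lemma has_derivative_quad4: "(quad4 has_derivative quad4' u) (at u)"
  unfolding quad4_def[abs_def] quad4'_def[abs_def]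
  by (auto intro!: derivative_eq_intros bounded_linear_imp_has_derivative bounded_linear_vec_nth simp: algebra_simps)

lemma C1_param_chart:
  assumes s: "s * s = 1"
  shows "C1_param {u. 1 + quad4 u \<noteq> 0} (chart s) (chart' s)"
proof -
  let ?U = "{u. 1 + quad4 u \<noteq> 0}"
  have cq: "continuous_on A quad4" for A unfolding quad4_def by (intro continuous_intros)
  have cq': "continuous_on A (\<lambda>u. quad4' u v)" for A v unfolding quad4'_def by (intro continuous_intros)
  have ce: "bounded_linear emb4" using linear_emb4 by (simp add: linear_conv_bounded_linear)
  have op: "open ?U" by (intro open_Collect_neq continuous_intros cq)
  have d: "(chart s has_derivative chart' s u) (at u)" if "u \<in> ?U" for u
    using that unfolding chart_def[abs_def] chart'_def[abs_def]
    by (auto intro!: derivative_eq_intros has_derivative_quad4 bounded_linear_imp_has_derivative[OF ce]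
         simp: power2_eq_square divide_simps)
  have inj: "inj (chart' s u)" if u: "u \<in> ?U" for u
  proof -
    have n: "1 + s * chart s u $ 1 \<noteq> 0"
    proof -
      have "1 + s * chart s u $ 1 = 2 / (1 + quad4 u)"
        using s u by (simp add: chart_nth mult.assoc[symmetric] field_simps)
      then show ?thesis using u by simp
    qed
    have "unchart s differentiable (at (chart s u))"
    proof -
      have l: "bounded_linear (\<lambda>x::real^5. vector [x$2, x$3, x$4, x$5] :: real^4)"
        unfolding linear_conv_bounded_linear[symmetric]
        by (rule linearI) (simp_all add: vec_eq_iff forall_4)
      show ?thesis unfolding unchart_def[abs_def]
        using n by (intro differentiable_scaleR differentiable_divide differentiable_add differentiable_mult
          differentiable_const bounded_linear_imp_differentiable[OF l]
          bounded_linear_imp_differentiable[OF bounded_linear_vec_nth])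
    qed
    then obtain D where D: "(unchart s has_derivative D) (at (chart s u))"
      by (auto simp: differentiable_def)
    have "((\<lambda>v. unchart s (chart s v)) has_derivative (\<lambda>h. D (chart' s u h))) (at u)"
      using d[OF u] D by (rule has_derivative_compose)
    moreover have "((\<lambda>v. unchart s (chart s v)) has_derivative (\<lambda>h. h)) (at u)"
      by (rule has_derivative_transform_within_open[OF has_derivative_ident op u])
         (use s in \<open>auto simp: unchart_chart\<close>)
    ultimately have "(\<lambda>h. D (chart' s u h)) = (\<lambda>h. h)" by (rule has_derivative_unique)
    then show ?thesis by (metis injI)
  qed
  have "continuous_on ?U (\<lambda>u. chart' s u v)" for v
    unfolding chart'_def using ce
    by (intro continuous_intros cq cq' linear_continuous_on) auto
  then show ?thesis
    unfolding C1_param_def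
    using op d inj chart_on_quadric[OF s] unchart_chart[OF s]
    by (auto intro!: inj_on_inverseI[of _ "unchart s"])
qed

lemma is_sphere_measureD:
  assumes "is_sphere_measure M" "C1_param U \<phi> \<phi>'" "A \<in> sets borel" "A \<subseteq> \<phi> ` U"
  shows "emeasure M A =
    (\<integral>\<^sup>+ u \<in> {u\<in>U. \<phi> u \<in> A}. ennreal \<bar>iota_vol (\<phi> u) (\<lambda>i. \<phi>' u (axis i 1))\<bar> \<partial>lborel)"
  using assms by (simp add: is_sphere_measure_def)

lemma sphere_measure_unique:
  assumes M: "is_sphere_measure M" and N: "is_sphere_measure N"
  shows "M = N"
proof (rule measure_eqI)
  have sM: "sets M = sets (restrict_space borel oriented_spheres)"
    and sN: "sets N = sets (restrict_space borel oriented_spheres)"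
    using M N by (auto simp: is_sphere_measure_def)
  then show "sets M = sets N" by simp
  have mem: "A \<in> sets M \<longleftrightarrow> A \<in> sets borel \<and> A \<subseteq> oriented_spheres" for A
    unfolding sM by (subst sets_restrict_space_iff) auto
  have eq: "emeasure M A = emeasure N A"
    if A: "A \<in> sets M" and s: "s * s = 1" and n: "\<And>x. x \<in> A \<Longrightarrow> 1 + s * x$1 \<noteq> 0" for A s
  proof -
    have "A \<subseteq> chart s ` {u. 1 + quad4 u \<noteq> 0}"
    proof
      fix x assume x: "x \<in> A"
      then have "x \<in> oriented_spheres" using A mem by blast
      then show "x \<in> chart s ` {u. 1 + quad4 u \<noteq> 0}"
        using chart_unchart[OF s _ n[OF x]] by (metis (mono_tags, lifting) image_eqI mem_Collect_eq)
    qed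
    moreover have "A \<in> sets borel" using A mem[of A] by simp
    ultimately show ?thesis
      using is_sphere_measureD[OF M C1_param_chart[OF s]] is_sphere_measureD[OF N C1_param_chart[OF s]]
      by simp
  qed
  fix A assume A: "A \<in> sets M"
  define A1 where "A1 = A \<inter> {x. 1 + x$1 \<noteq> 0}"
  define A2 where "A2 = A \<inter> {x. 1 + x$1 = 0}"
  have "A \<in> sets borel" using A mem[of A] by simp
  then have "A1 \<in> sets borel" "A2 \<in> sets borel" unfolding A1_def A2_def
    by (auto intro!: sets.Int borel_open borel_closed open_Collect_neq closed_Collect_eq continuous_intros)
  then have mm: "A1 \<in> sets M" "A2 \<in> sets M" using A unfolding mem by (auto simp: A1_def A2_def)
  then have mn: "A1 \<in> sets N" "A2 \<in> sets N" by (auto simp: sM sN)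
  have A12: "A = A1 \<union> A2" "A1 \<inter> A2 = {}" by (auto simp: A1_def A2_def)
  have e1: "emeasure M A1 = emeasure N A1" by (rule eq[of _ 1]) (use mm in \<open>auto simp: A1_def\<close>)
  have e2: "emeasure M A2 = emeasure N A2" by (rule eq[of _ "-1"]) (use mm in \<open>auto simp: A2_def\<close>)
  show "emeasure M A = emeasure N A"
    using e1 e2 plus_emeasure[OF mm A12(2)] plus_emeasure[OF mn A12(2)] A12(1) by simp
qed

lemma is_sphere_measure_the: "is_sphere_measure (THE M. is_sphere_measure M)"
proof -
  obtain M where M: "is_sphere_measure M" using sphere_measure_exists ..
  then show ?thesis by (rule theI) (rule sphere_measure_unique[OF _ M])
qed

end

theory Submission
  imports Defs
begin

text \<open>
  The Lorentz transformations of \<open>\<real>\<^sup>5\<close> that preserve the two halves of the light cone act on its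
  future null rays, and this action is the conformal group.  A point \<open>z\<close> of \<open>S\<^sup>3\<close> spans the null ray through
  \<open>light z = (stereo z, 1)\<close>, and a sphere \<open>x\<close> is the set of rays Lorentz-orthogonal to \<open>x\<close>.
  The reflection in the sphere \<open>n\<close> corresponds to the linear reflection \<open>reflect n\<close> along the unit
  vector \<open>n\<close>: it sends \<open>light z\<close> to \<open>w z\<close> times \<open>light (g z)\<close> with a positive factor \<open>w z\<close>.
  This is checked on coordinates for inversions and for plane reflections; everything else is a
  consequence of this one relation, recorded in the locale \<open>sphere_reflection\<close>.

  Incidence is preserved because the Lorentz form is: the equation of the image sphere at \<open>g z\<close> is
  the equation of the sphere at \<open>z\<close> divided by \<open>w z\<close>.  So points of intersection and sides are
  carried along.  Squared chordal distances are Lorentz products of light vectors, hence they are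
  divided by \<open>w y * w z\<close>.  Since \<open>w\<close> is bounded away from \<open>0\<close>, the map is Lipschitz, and so
  is its inverse, which is the map itself.  It follows that it preserves the order of contact, on
  which the multiplicities depend, and the connected components of the pieces of \<open>K\<close>
  (\<open>multiplicity_at_reflect\<close>, \<open>components_sphere_map\<close>).

  The measure is preserved because \<open>reflect n\<close> has determinant \<open>\<plusminus>1\<close> and carries local
  parametrizations of the space of spheres to such parametrizations; the uniqueness of the
  invariant measure then says that its push-forward is the measure itself (\<open>distr_reflect\<close>).

  Hence each of the three functionals is invariant under each reflection (\<open>mnts_reflection\<close>),
  and the general case follows by composition.
\<close>

section \<open>Lorentz reflections preserve the measure on the space of spheres\<close>

definition reflect :: "real^5 \<Rightarrow> real^5 \<Rightarrow> real^5" where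
  "reflect n x = x - (2 * lorentz x n) *\<^sub>R n"

lemma lorentz_commute: "lorentz x y = lorentz y x"
  by (simp add: lorentz_def mult.commute)

lemma lorentz_add: "lorentz (x + y) z = lorentz x z + lorentz y z"
  and lorentz_diff: "lorentz (x - y) z = lorentz x z - lorentz y z"
  and lorentz_scale: "lorentz (k *\<^sub>R x) z = k * lorentz x z"
  by (simp_all add: lorentz_def algebra_simps)

lemma lorentz_diff_right: "lorentz z (x - y) = lorentz z x - lorentz z y"
  and lorentz_scale_right: "lorentz z (k *\<^sub>R x) = k * lorentz z x"
  by (simp_all add: lorentz_def algebra_simps)

lemma linear_reflect: "linear (reflect n)"
  by (rule linearI) (simp_all add: reflect_def lorentz_add lorentz_scale algebra_simps)

lemma bounded_linear_reflect: "bounded_linear (reflect n)"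
  using linear_reflect by (simp add: linear_conv_bounded_linear)

lemma lorentz_reflect:
  assumes "n \<in> oriented_spheres"
  shows "lorentz (reflect n x) (reflect n y) = lorentz x y"
proof -
  have "lorentz n n = 1" using assms by (simp add: oriented_spheres_def)
  moreover have "lorentz n y = lorentz y n" by (rule lorentz_commute)
  ultimately show ?thesis
    by (simp add: reflect_def lorentz_diff lorentz_diff_right lorentz_scale lorentz_scale_right)
qed

lemma reflect_reflect:
  assumes "n \<in> oriented_spheres"
  shows "reflect n (reflect n x) = x"
proof -
  have "lorentz (reflect n x) n = - lorentz x n"
    using assms by (simp add: oriented_spheres_def reflect_def lorentz_diff lorentz_scale)
  then have "reflect n (reflect n x) = reflect n x + (2 * lorentz x n) *\<^sub>R n"
    by (simp add: reflect_def[of n "reflect n x"])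
  then show ?thesis by (simp add: reflect_def)
qed

lemma reflect_oriented_spheres:
  assumes "n \<in> oriented_spheres"
  shows "reflect n x \<in> oriented_spheres \<longleftrightarrow> x \<in> oriented_spheres"
  using lorentz_reflect[OF assms] by (simp add: oriented_spheres_def)

text \<open>The vectors are the rows of a matrix, so that \<open>T\<close> acts on it by multiplication on the right.\<close>

lemma iota_vol_linear:
  assumes T: "linear T"
  shows "iota_vol (T x) (\<lambda>i. T (v i)) = det (matrix T) * iota_vol x v"
proof -
  let ?A = "vector [x, v 1, v 2, v 3, v 4] :: real^5^5"
  have "(vector [T x, T (v 1), T (v 2), T (v 3), T (v 4)] :: real^5^5) = (\<chi> i. T (?A $ i))"
    by (simp add: vec_eq_iff forall_5)
  also have "\<dots> = ?A ** transpose (matrix T)"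
  proof -
    have "T y $ j = (\<Sum>k\<in>UNIV. y $ k * matrix T $ j $ k)" for y j
    proof -
      have "T y = matrix T *v y" by (simp only: matrix_vector_mul(2)[OF T])
      then show ?thesis by (simp add: matrix_vector_mult_def mult.commute)
    qed
    then show ?thesis by (simp add: vec_eq_iff matrix_matrix_mult_def transpose_def)
  qed
  finally show ?thesis by (simp add: iota_vol_def det_mul det_transpose)
qed

lemma abs_det_reflect:
  assumes "n \<in> oriented_spheres"
  shows "\<bar>det (matrix (reflect n))\<bar> = 1"
proof -
  have "matrix (reflect n) ** matrix (reflect n) = matrix (reflect n \<circ> reflect n)"
    by (rule matrix_compose[symmetric]) (rule linear_reflect)+
  also have "reflect n \<circ> reflect n = id" using reflect_reflect[OF assms] by auto
  finally have "det (matrix (reflect n)) * det (matrix (reflect n)) = 1"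
    by (metis det_mul det_I matrix_id_mat_1)
  then show ?thesis unfolding power2_eq_square[symmetric] abs_square_eq_1 .
qed

lemma C1_param_reflect:
  assumes n: "n \<in> oriented_spheres" and p: "C1_param U \<phi> \<phi>'"
  shows "C1_param U (\<lambda>u. reflect n (\<phi> u)) (\<lambda>u v. reflect n (\<phi>' u v))"
proof -
  have i: "inj (reflect n)" by (metis injI reflect_reflect[OF n])
  have "inj_on (reflect n \<circ> \<phi>) U"
    using p i by (auto simp: C1_param_def intro!: comp_inj_on intro: inj_on_subset)
  moreover have "inj (\<lambda>v. reflect n (\<phi>' u v))" if "u \<in> U" for u
    using inj_compose[OF i] p that by (auto simp: C1_param_def o_def)
  ultimately show ?thesis using p
    by (auto simp: C1_param_def o_def reflect_oriented_spheres[OF n]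
       intro!: bounded_linear.has_derivative[OF bounded_linear_reflect]
         bounded_linear.continuous_on[OF bounded_linear_reflect])
qed

lemma reflect_measurable:
  assumes n: "n \<in> oriented_spheres" and M: "is_sphere_measure M"
  shows "reflect n \<in> M \<rightarrow>\<^sub>M M" "space M = oriented_spheres"
proof -
  have s: "sets M = sets (restrict_space borel oriented_spheres)"
    using M by (simp add: is_sphere_measure_def)
  show "space M = oriented_spheres"
    using sets_eq_imp_space_eq[OF s] by (simp add: space_restrict_space)
  have "reflect n \<in> borel_measurable borel"
    by (intro borel_measurable_continuous_onI linear_continuous_on bounded_linear_reflect)
  then have "reflect n \<in> restrict_space borel oriented_spheres \<rightarrow>\<^sub>M restrict_space borel oriented_spheres"
    by (intro measurable_restrict_space2 measurable_restrict_space1)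
       (auto simp: space_restrict_space reflect_oriented_spheres[OF n])
  then show "reflect n \<in> M \<rightarrow>\<^sub>M M" by (simp cong: measurable_cong_sets add: s)
qed

text \<open>By uniqueness it suffices to test the push-forward in local parametrizations.  There it is the
  measure of the reflected set in the reflected parametrization, whose density is the same because
  the determinant of the reflection has absolute value \<open>1\<close>.\<close>

lemma distr_reflect:
  assumes n: "n \<in> oriented_spheres" and M: "is_sphere_measure M"
  shows "distr M M (reflect n) = M"
proof (rule sphere_measure_unique[OF _ M], unfold is_sphere_measure_def, intro conjI allI impI ballI)
  have s: "sets M = sets (restrict_space borel oriented_spheres)"
    using M by (simp add: is_sphere_measure_def)
  then show "sets (distr M M (reflect n)) = sets (restrict_space borel oriented_spheres)" by simp
  fix U \<phi> \<phi>' A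
  assume p: "C1_param U \<phi> \<phi>'" and A: "A \<in> sets borel" "A \<subseteq> \<phi> ` U"
  let ?T = "reflect n"
  have AS: "A \<subseteq> oriented_spheres" using A p by (auto simp: C1_param_def)
  have AM: "A \<in> sets M" unfolding s using A AS by (subst sets_restrict_space_iff) auto
  have im: "?T -` A \<inter> space M = ?T ` A"
  proof -
    have "x \<in> ?T ` A \<longleftrightarrow> ?T x \<in> A" for x using reflect_reflect[OF n] by (metis image_iff)
    then have "?T -` A = ?T ` A" by blast
    then show ?thesis using AS reflect_oriented_spheres[OF n] by (auto simp: reflect_measurable[OF n M])
  qed
  have "?T ` A \<in> sets M"
    using measurable_sets[OF reflect_measurable(1)[OF n M] AM] unfolding im .
  then have TA: "?T ` A \<in> sets borel" unfolding s by (subst (asm) sets_restrict_space_iff) auto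
  have inj: "?T x \<in> ?T ` A \<longleftrightarrow> x \<in> A" for x by (metis image_iff reflect_reflect[OF n])
  have "emeasure (distr M M ?T) A = emeasure M (?T ` A)"
    unfolding im[symmetric] by (rule emeasure_distr[OF reflect_measurable(1)[OF n M] AM])
  also have "\<dots> = (\<integral>\<^sup>+ u \<in> {u\<in>U. ?T (\<phi> u) \<in> ?T ` A}.
      ennreal \<bar>iota_vol (?T (\<phi> u)) (\<lambda>i. ?T (\<phi>' u (axis i 1)))\<bar> \<partial>lborel)"
    using A by (intro is_sphere_measureD[OF M C1_param_reflect[OF n p] TA]) auto
  also have "\<dots> = (\<integral>\<^sup>+ u \<in> {u\<in>U. \<phi> u \<in> A}. ennreal \<bar>iota_vol (\<phi> u) (\<lambda>i. \<phi>' u (axis i 1))\<bar> \<partial>lborel)"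
    by (simp add: inj iota_vol_linear[OF linear_reflect] abs_mult abs_det_reflect[OF n])
  finally show "emeasure (distr M M ?T) A =
    (\<integral>\<^sup>+ u \<in> {u\<in>U. \<phi> u \<in> A}. ennreal \<bar>iota_vol (\<phi> u) (\<lambda>i. \<phi>' u (axis i 1))\<bar> \<partial>lborel)" .
qed

text \<open>Passing to the completion needs only that the reflection preserves null sets.\<close>

lemma dSigma_reflect:
  assumes n: "n \<in> oriented_spheres"
  shows "reflect n \<in> dSigma \<rightarrow>\<^sub>M dSigma" "distr dSigma dSigma (reflect n) = dSigma"
    "space dSigma = oriented_spheres"
proof -
  define M where "M = (THE M. is_sphere_measure M)"
  have M: "is_sphere_measure M" unfolding M_def by (rule is_sphere_measure_the)
  have d: "dSigma = completion M" by (simp add: dSigma_def M_def)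
  have m: "reflect n \<in> completion M \<rightarrow>\<^sub>M M"
    by (rule measurable_completion[OF reflect_measurable(1)[OF n M]])
  have e: "distr (completion M) M (reflect n) = M"
    using distr_completion[OF reflect_measurable(1)[OF n M]] distr_reflect[OF n M] by simp
  show "reflect n \<in> dSigma \<rightarrow>\<^sub>M dSigma"
    unfolding d by (rule completion.measurable_completion2[OF m]) (unfold e, rule order_refl)
  show "distr dSigma dSigma (reflect n) = dSigma"
    unfolding d by (rule completion.completion_distr_eq[OF m, unfolded e, OF refl, symmetric])
  show "space dSigma = oriented_spheres"
    by (simp add: d reflect_measurable[OF n M])
qed

text \<open>If \<open>A\<close> is not measurable, then neither is its image, since \<open>T\<close> is its own inverse, and both sides
  are the default value \<open>0\<close>.\<close>

lemma emeasure_involution: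
  assumes T: "T \<in> N \<rightarrow>\<^sub>M N" "distr N N T = N" and inv: "\<And>x. T (T x) = x" and A: "A \<subseteq> space N"
  shows "emeasure N (T ` A) = emeasure N A"
proof -
  have im: "T ` B = T -` B \<inter> space N" if "B \<subseteq> space N" for B
  proof (intro equalityI subsetI)
    fix x assume "x \<in> T ` B"
    then show "x \<in> T -` B \<inter> space N" using that measurable_space[OF T(1)] inv by auto
  next
    fix x assume "x \<in> T -` B \<inter> space N"
    then have "T (T x) \<in> T ` B" by blast
    then show "x \<in> T ` B" by (simp only: inv)
  qed
  have TA: "T ` A \<subseteq> space N" using A measurable_space[OF T(1)] by auto
  have TTA: "T ` T ` A = A" by (simp add: image_image inv)
  show ?thesis
  proof (cases "A \<in> sets N")
    case True
    then have "emeasure (distr N N T) A = emeasure N (T ` A)"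
      unfolding im[OF A] by (rule emeasure_distr[OF T(1)])
    then show ?thesis by (simp only: T(2))
  next
    case False
    then have "T ` A \<notin> sets N"
      using measurable_sets[OF T(1)] im[OF TA] TTA by metis
    then show ?thesis using False by (simp add: emeasure_notin_sets)
  qed
qed

text \<open>The integral is the supremum over simple functions also when \<open>f\<close> is not measurable.  A simple
  function below \<open>f\<close> is pulled back to a measurable one below \<open>f \<circ> T\<close>, which gives one inequality;
  the same inequality for \<open>f \<circ> T\<close> gives the other.\<close>

lemma nn_integral_involution:
  fixes f :: "'a \<Rightarrow> ennreal"
  assumes T: "T \<in> N \<rightarrow>\<^sub>M N" "distr N N T = N" and inv: "\<And>x. T (T x) = x"
  shows "(\<integral>\<^sup>+x. f (T x) \<partial>N) = (\<integral>\<^sup>+x. f x \<partial>N)"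
proof -
  have le: "(\<integral>\<^sup>+x. f x \<partial>N) \<le> (\<integral>\<^sup>+x. f (T x) \<partial>N)" for f :: "'a \<Rightarrow> ennreal"
    unfolding nn_integral_def[of N f]
  proof (rule SUP_least, safe)
    fix s assume s: "simple_function N s" "s \<le> f"
    have "integral\<^sup>S N s = (\<integral>\<^sup>+x. s x \<partial>distr N N T)"
      unfolding T(2) using s by (simp add: nn_integral_eq_simple_integral)
    also have "\<dots> = (\<integral>\<^sup>+x. s (T x) \<partial>N)"
      using s by (intro nn_integral_distr[OF T(1)]) (simp add: borel_measurable_simple_function)
    also have "\<dots> \<le> (\<integral>\<^sup>+x. f (T x) \<partial>N)"
      using s by (intro nn_integral_mono) (auto simp: le_fun_def)
    finally show "integral\<^sup>S N s \<le> (\<integral>\<^sup>+x. f (T x) \<partial>N)" .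
  qed
  from le[of f] le[of "\<lambda>x. f (T x)"] show ?thesis by (simp add: inv)
qed


section \<open>Reflections acting on points and on spheres\<close>

definition light :: "S3 \<Rightarrow> real^5" where
  "light z = vector [stereo z $ 1, stereo z $ 2, stereo z $ 3, stereo z $ 4, 1]"

text \<open>The multiple of \<^term>\<open>light (Some p)\<close> with polynomial coordinates.\<close>

definition null_vec :: "real^3 \<Rightarrow> real^5" where
  "null_vec p = vector [2 * p$1, 2 * p$2, 2 * p$3, (norm p)\<^sup>2 - 1, (norm p)\<^sup>2 + 1]"

lemma norm_sq_3: "(norm p)\<^sup>2 = (p$1)\<^sup>2 + (p$2)\<^sup>2 + (p$3)\<^sup>2" for p :: "real^3"
  unfolding power2_norm_eq_inner by (simp add: inner_vec_def sum_3 power2_eq_square)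

lemma norm_sq_4: "(norm p)\<^sup>2 = (p$1)\<^sup>2 + (p$2)\<^sup>2 + (p$3)\<^sup>2 + (p$4)\<^sup>2" for p :: "real^4"
  unfolding power2_norm_eq_inner by (simp add: inner_vec_def sum_4 power2_eq_square)

lemma norm_sq_plus_1: "(norm p)\<^sup>2 + 1 > 0" for p :: "real^3"
  by (smt (verit) zero_le_power2)

lemma light_None: "light None = vector [0, 0, 0, 1, 1]"
  by (simp add: light_def)

lemma light_Some: "light (Some p) = (1 / ((norm p)\<^sup>2 + 1)) *\<^sub>R null_vec p"
  using norm_sq_plus_1[of p] by (simp add: light_def null_vec_def vec_eq_iff forall_5)

lemma light_5 [simp]: "light z $ 5 = 1"
  by (simp add: light_def)

lemma inj_light: "light y = light z \<Longrightarrow> y = z"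
proof -
  have ns: "light None \<noteq> light (Some p)" for p
    using norm_sq_plus_1[of p]
    by (auto simp: light_None light_Some null_vec_def vec_eq_iff forall_5 field_simps)
  have ss: "p = q" if "light (Some p) = light (Some q)" for p q
  proof -
    define a b where "a = (norm p)\<^sup>2 + 1" and "b = (norm q)\<^sup>2 + 1"
    have ab: "a > 0" "b > 0" using norm_sq_plus_1 by (auto simp: a_def b_def)
    have e: "(1 / a) *\<^sub>R null_vec p = (1 / b) *\<^sub>R null_vec q" using that by (simp add: light_Some a_def b_def)
    then have "(1 / a) * (a - 2) = (1 / b) * (b - 2)"
      by (simp add: vec_eq_iff forall_5 null_vec_def a_def b_def)
    then have "a = b" using ab by (simp add: field_simps)
    then show ?thesis using e ab by (simp add: vec_eq_iff forall_5 forall_3 null_vec_def)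
  qed
  assume "light y = light z"
  then show ?thesis using ns ss by (cases y; cases z) (auto, metis)
qed

lemma light_eq_stereo: "stereo y = stereo z \<Longrightarrow> light y = light z"
  by (simp add: light_def)

lemma inj_stereo: "inj stereo"
  using inj_light light_eq_stereo by (blast intro: injI)

lemma lorentz_null: "lorentz (null_vec p) (null_vec p) = 0"
proof -
  have "lorentz (null_vec p) (null_vec p) = 4 * ((p$1)\<^sup>2 + (p$2)\<^sup>2 + (p$3)\<^sup>2) - 4 * (norm p)\<^sup>2"
    by (simp add: lorentz_def null_vec_def power2_eq_square algebra_simps)
  then show ?thesis by (simp add: norm_sq_3)
qed

lemma lorentz_light: "lorentz (light z) (light z) = 0"
  by (cases z) (simp_all add: light_None light_Some lorentz_scaleR lorentz_null, simp add: lorentz_def)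

lemma sphere_fun_stereo: "sphere_fun x (stereo z) = lorentz x (light z)"
  by (simp add: sphere_fun_def light_def)

text \<open>Light vectors have last coordinate \<open>1\<close>, so their difference is space-like and its Lorentz square
  is the Euclidean one; the two diagonal terms vanish.\<close>

lemma dist_stereo_sq: "(dist (stereo y) (stereo z))\<^sup>2 = - 2 * lorentz (light y) (light z)"
proof -
  have "(dist (stereo y) (stereo z))\<^sup>2 = lorentz (light y - light z) (light y - light z)"
    unfolding dist_norm norm_sq_4 by (simp add: lorentz_def light_def power2_eq_square)
  then show ?thesis
    by (simp add: lorentz_diff lorentz_diff_right lorentz_light lorentz_commute[of "light z" "light y"])
qed

text \<open>A conformal reflection \<open>g\<close> of \<open>S\<^sup>3\<close> that is induced by the linear reflection along \<open>n\<close>.  Positivity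
  of the factor means that the reflection does not exchange the two halves of the light cone, and
  is what makes \<open>g\<close> respect the sides of a sphere.\<close>

locale sphere_reflection =
  fixes n :: "real^5" and g :: "S3 \<Rightarrow> S3"
  assumes n: "n \<in> oriented_spheres"
    and light_image: "\<exists>w>0. reflect n (light z) = w *\<^sub>R light (g z)"
begin

definition weight :: "S3 \<Rightarrow> real" where
  "weight z = reflect n (light z) $ 5"

lemma weight: "weight z > 0" "reflect n (light z) = weight z *\<^sub>R light (g z)"
proof -
  obtain w where "w > 0" "reflect n (light z) = w *\<^sub>R light (g z)" using light_image by blast
  then show "weight z > 0" "reflect n (light z) = weight z *\<^sub>R light (g z)"
    by (simp_all add: weight_def)
qed

lemma light_weights: "light z = (weight z * weight (g z)) *\<^sub>R light (g (g z))"
proof -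
  have "light z = reflect n (reflect n (light z))" by (simp add: reflect_reflect[OF n])
  also have "\<dots> = (weight z * weight (g z)) *\<^sub>R light (g (g z))"
    by (simp add: weight(2) linear_scale[OF linear_reflect])
  finally show ?thesis .
qed

lemma weight_weight: "weight z * weight (g z) = 1"
  using arg_cong[OF light_weights[of z], of "\<lambda>v. v $ 5"] by simp

lemma involution [simp]: "g (g z) = z"
  using light_weights[of z] inj_light by (simp add: weight_weight)

lemma inj: "inj g"
  by (metis injI involution)

text \<open>The light vectors all have the same norm, so the linear map \<open>reflect n\<close> bounds the weights from
  above.  Since the weights at \<open>z\<close> and \<open>g z\<close> are inverse to each other, this bounds them from below.\<close>

lemma weight_bounded_below:
  obtains B where "B > 0" "\<And>z. 1 / B \<le> weight z"
proof -
  obtain C where C: "\<And>x. norm (reflect n x) \<le> norm x * C" "C > 0"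
    using bounded_linear.pos_bounded[OF bounded_linear_reflect] by blast
  have "norm (light z) = sqrt 2" for z
  proof -
    have "(norm (light z))\<^sup>2 = lorentz (light z) (light z) + 2"
      unfolding power2_norm_eq_inner by (simp add: inner_vec_def sum_5 lorentz_def)
    then show ?thesis by (simp add: lorentz_light real_sqrt_unique)
  qed
  then have up: "weight z \<le> sqrt 2 * C" for z
    unfolding weight_def
    using C(1)[of "light z"] component_le_norm_cart[of "reflect n (light z)" 5] by simp
  have lo: "1 / (sqrt 2 * C) \<le> weight z" for z
    using up[of "g z"] weight_weight[of z] weight(1)[of z] weight(1)[of "g z"] C(2)
    by (simp add: divide_simps) (metis mult.commute mult_left_mono less_imp_le)
  show ?thesis using that[OF _ lo] C(2) by simp
qed

lemma sphere_fun_reflect: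
  "sphere_fun (reflect n x) (stereo (g z)) = sphere_fun x (stereo z) / weight z"
proof -
  have "sphere_fun x (stereo z) = lorentz (reflect n x) (reflect n (light z))"
    by (simp add: sphere_fun_stereo lorentz_reflect[OF n])
  also have "\<dots> = weight z * sphere_fun (reflect n x) (stereo (g z))"
    by (simp add: weight(2) lorentz_scale_right sphere_fun_stereo)
  finally show ?thesis using weight(1)[of z] by simp
qed

lemma image_iff_involution: "z \<in> g ` A \<longleftrightarrow> g z \<in> A"
  by (metis image_iff involution)

lemma sphere_of_reflect: "sphere_of (reflect n x) = g ` sphere_of x"
proof (rule Set.set_eqI)
  fix z
  show "z \<in> sphere_of (reflect n x) \<longleftrightarrow> z \<in> g ` sphere_of x"
    using sphere_fun_reflect[of x "g z"] weight(1)[of "g z"]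
    unfolding image_iff_involution by (simp add: sphere_of_def)
qed

lemma int_ball_of_reflect: "int_ball_of (reflect n x) = g ` int_ball_of x"
proof (rule Set.set_eqI)
  fix z
  show "z \<in> int_ball_of (reflect n x) \<longleftrightarrow> z \<in> g ` int_ball_of x"
    using sphere_fun_reflect[of x "g z"] weight(1)[of "g z"]
    unfolding image_iff_involution by (simp add: int_ball_of_def zero_less_divide_iff)
qed

lemma dist_stereo_image:
  "(dist (stereo (g y)) (stereo (g z)))\<^sup>2 * (weight y * weight z) = (dist (stereo y) (stereo z))\<^sup>2"
proof -
  have "lorentz (light y) (light z) = lorentz (reflect n (light y)) (reflect n (light z))"
    by (simp add: lorentz_reflect[OF n])
  also have "\<dots> = lorentz (light (g y)) (light (g z)) * (weight y * weight z)"
    by (simp add: weight(2) lorentz_scale lorentz_scale_right)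
  finally show ?thesis by (simp add: dist_stereo_sq)
qed

lemma dist_stereo_le:
  assumes B: "B > 0" "\<And>z. 1 / B \<le> weight z"
  shows "dist (stereo (g y)) (stereo (g z)) \<le> B * dist (stereo y) (stereo z)"
proof (rule power2_le_imp_le)
  let ?d = "dist (stereo (g y)) (stereo (g z))"
  have w: "1 \<le> B * weight u" for u
    using mult_left_mono[OF B(2)[of u], of B] B(1) by simp
  have "1 \<le> B * weight y * (B * weight z)"
    using mult_mono[OF w[of y] w[of z]] w[of y] by linarith
  then have "?d\<^sup>2 * 1 \<le> ?d\<^sup>2 * (B * weight y * (B * weight z))"
    by (intro mult_left_mono) auto
  also have "\<dots> = B\<^sup>2 * (?d\<^sup>2 * (weight y * weight z))" by (simp add: power2_eq_square)
  finally show "?d\<^sup>2 \<le> (B * dist (stereo y) (stereo z))\<^sup>2"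
    by (simp add: dist_stereo_image power_mult_distrib)
qed (use B(1) in simp)

text \<open>Both the equation of the sphere and the chordal distance change by factors that are bounded, so
  that \<open>o(s\<^sup>j)\<close> is preserved.\<close>

lemma contact_order_reflect:
  assumes o: "sphere_fun x \<in> o[at (stereo z) within stereo ` K](\<lambda>q. norm (q - stereo z) ^ j)"
  shows "sphere_fun (reflect n x) \<in>
    o[at (stereo (g z)) within stereo ` g ` K](\<lambda>q. norm (q - stereo (g z)) ^ j)"
proof (rule landau_o.smallI)
  fix c :: real assume c: "c > 0"
  obtain B where B: "B > 0" "\<And>z. 1 / B \<le> weight z"
    using weight_bounded_below by blast
  \<comment> \<open>One power of \<open>B\<close> pays for the factor of the equation, the others for the distance to the power \<open>j\<close>.\<close>
  have "c / B ^ Suc j > 0" using c B by simp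
  from landau_o.smallD[OF o this] obtain d where d: "d > 0"
    and near: "\<And>y. y \<in> K \<Longrightarrow> stereo y \<noteq> stereo z \<Longrightarrow> dist (stereo y) (stereo z) < d \<Longrightarrow>
      \<bar>sphere_fun x (stereo y)\<bar> \<le> c / B ^ Suc j * dist (stereo y) (stereo z) ^ j"
    unfolding eventually_at by (auto simp: dist_norm)
  have main: "\<bar>sphere_fun (reflect n x) (stereo (g y))\<bar> \<le> c * dist (stereo (g y)) (stereo (g z)) ^ j"
    if y: "y \<in> K" "stereo (g y) \<noteq> stereo (g z)" "dist (stereo (g y)) (stereo (g z)) < d / B" for y
  proof -
    \<comment> \<open>The Lipschitz estimate is used from the image back to the source, which is possible as \<open>g\<close> is an involution.\<close>
    have le: "dist (stereo y) (stereo z) \<le> B * dist (stereo (g y)) (stereo (g z))"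
      using dist_stereo_le[OF B, of "g y" "g z"] by simp
    also have "\<dots> < d" using y(3) B(1) by (simp add: field_simps)
    finally have "dist (stereo y) (stereo z) < d" .
    moreover have "stereo y \<noteq> stereo z" using y(2) inj_stereo by (metis injD)
    ultimately have "\<bar>sphere_fun x (stereo y)\<bar> \<le> c / B ^ Suc j * dist (stereo y) (stereo z) ^ j"
      using near y(1) by blast
    also have "\<dots> \<le> c / B ^ Suc j * (B * dist (stereo (g y)) (stereo (g z))) ^ j"
      using le c B(1) by (intro mult_left_mono power_mono) auto
    also have "\<dots> = (1 / B) * (c * dist (stereo (g y)) (stereo (g z)) ^ j)"
      using B(1) by (simp add: power_mult_distrib)
    also have "\<dots> \<le> weight y * (c * dist (stereo (g y)) (stereo (g z)) ^ j)"
      using B(2) c by (intro mult_right_mono) auto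
    finally show ?thesis
      using weight(1)[of y] by (simp add: sphere_fun_reflect abs_divide pos_divide_le_eq mult.commute)
  qed
  show "\<forall>\<^sub>F q in at (stereo (g z)) within stereo ` g ` K.
      norm (sphere_fun (reflect n x) q) \<le> c * norm (norm (q - stereo (g z)) ^ j)"
    unfolding eventually_at
  proof (intro exI[of _ "d / B"] conjI ballI impI)
    fix q assume "q \<in> stereo ` g ` K" "q \<noteq> stereo (g z) \<and> dist q (stereo (g z)) < d / B"
    then show "norm (sphere_fun (reflect n x) q) \<le> c * norm (norm (q - stereo (g z)) ^ j)"
      using main by (auto simp: dist_norm)
  qed (use d B(1) in simp)
qed

text \<open>The converse implication is the same one for the reflected data.\<close>

lemma multiplicity_at_reflect:
  "multiplicity_at (g ` K) (reflect n x) (g z) = multiplicity_at K x z"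
proof -
  have "(sphere_fun (reflect n x) \<in>
      o[at (stereo (g z)) within stereo ` g ` K](\<lambda>q. norm (q - stereo (g z)) ^ j)) \<longleftrightarrow>
    (sphere_fun x \<in> o[at (stereo z) within stereo ` K](\<lambda>q. norm (q - stereo z) ^ j))" for j
    using contact_order_reflect[of x z K j] contact_order_reflect[of "reflect n x" "g z" "g ` K" j]
    by (auto simp: reflect_reflect[OF n] image_image)
  then show ?thesis by (simp add: multiplicity_at_def)
qed

lemma intersection_count_reflect: "intersection_count (g ` K) (reflect n x) = intersection_count K x"
proof -
  have e: "sphere_of (reflect n x) \<inter> g ` K = g ` (sphere_of x \<inter> K)"
    by (simp add: sphere_of_reflect image_Int[OF inj])
  have i: "inj_on g A" for A using inj by (rule inj_on_subset) simp
  show ?thesis unfolding intersection_count_def e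
    by (simp add: finite_image_iff[OF i] sum.reindex[OF i] multiplicity_at_reflect)
qed

lemma NT_bar_image: "NT_bar (g ` K) = reflect n ` NT_bar K"
proof -
  have "x \<in> NT_bar (g ` K) \<longleftrightarrow> reflect n x \<in> NT_bar K" for x
    using intersection_count_reflect[of K "reflect n x"]
    by (simp add: NT_bar_def reflect_oriented_spheres[OF n] reflect_reflect[OF n])
  moreover have "x \<in> reflect n ` A \<longleftrightarrow> reflect n x \<in> A" for x A
    using reflect_reflect[OF n] by (metis image_iff)
  ultimately show ?thesis by blast
qed

text \<open>The action of \<open>g\<close> transported to the unit sphere of \<open>\<real>\<^sup>4\<close>.\<close>

definition sphere_map :: "real^4 \<Rightarrow> real^4" where
  "sphere_map q = stereo (g (inv_into UNIV stereo q))"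

lemma sphere_map_stereo [simp]: "sphere_map (stereo z) = stereo (g z)"
  by (simp add: sphere_map_def inv_f_f[OF inj_stereo])

lemma sphere_map_image: "sphere_map ` stereo ` A = stereo ` g ` A"
  by (simp add: image_image)

lemma continuous_on_sphere_map: "continuous_on (range stereo) sphere_map"
proof -
  obtain B where B: "B > 0" "\<And>z. 1 / B \<le> weight z"
    using weight_bounded_below by blast
  have "B-lipschitz_on (range stereo) sphere_map"
    using dist_stereo_le[OF B] B(1) by (auto simp: lipschitz_on_def)
  then show ?thesis by (rule lipschitz_on_continuous_on)
qed

text \<open>Components are the maximal connected subsets, and \<open>sphere_map\<close> is a homeomorphism of the sphere
  because it is continuous and its own inverse there.\<close>

lemma components_sphere_map:
  assumes C: "C \<in> components (stereo ` A)"
  shows "sphere_map ` C \<in> components (stereo ` g ` A)"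
  unfolding in_components_maximal
proof (intro conjI allI impI)
  have sub: "C \<subseteq> stereo ` A" by (rule in_components_subset[OF C])
  show "sphere_map ` C \<noteq> {}" using in_components_nonempty[OF C] by simp
  show "sphere_map ` C \<subseteq> stereo ` g ` A"
    using image_mono[OF sub, of sphere_map] by (simp only: sphere_map_image)
  show "connected (sphere_map ` C)"
    by (rule connected_continuous_image[OF continuous_on_subset[OF continuous_on_sphere_map]])
       (use sub in_components_connected[OF C] in auto)
  fix D assume D: "D \<noteq> {} \<and> sphere_map ` C \<subseteq> D \<and> D \<subseteq> stereo ` g ` A \<and> connected D"
  then have "D \<noteq> {}" and CD: "sphere_map ` C \<subseteq> D" and DA: "D \<subseteq> stereo ` g ` A"
    and conn: "connected D" by auto
  have twice: "sphere_map ` sphere_map ` stereo ` E = stereo ` E" for E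
    by (simp add: image_image)
  obtain C0 D0 where C0: "C = stereo ` C0" and D0: "D = stereo ` g ` D0" "D0 \<subseteq> A"
    using sub DA unfolding subset_image_iff by blast
  have max: "E = C" if "E \<noteq> {}" "C \<subseteq> E" "E \<subseteq> stereo ` A" "connected E" for E
    using C that unfolding in_components_maximal by simp
  have "sphere_map ` D = C"
  proof (rule max)
    show "sphere_map ` D \<noteq> {}" using \<open>D \<noteq> {}\<close> by simp
    show "C \<subseteq> sphere_map ` D" using image_mono[OF CD, of sphere_map] by (simp only: C0 twice)
    show "sphere_map ` D \<subseteq> stereo ` A" using D0(2) by (simp add: D0(1) image_image image_mono)
    have "D \<subseteq> range stereo" unfolding D0(1) by (rule image_mono) simp
    then show "connected (sphere_map ` D)"
      using conn by (intro connected_continuous_image continuous_on_subset[OF continuous_on_sphere_map])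
  qed
  then have "sphere_map ` C = sphere_map ` sphere_map ` D" by simp
  then show "D = sphere_map ` C" by (simp only: D0(1) twice)
qed

lemma NT_reflect:
  assumes "x \<in> NT K" shows "reflect n x \<in> NT (g ` K)"
proof -
  from assms obtain C1 C2 where x: "x \<in> oriented_spheres" and ne: "C1 \<noteq> C2"
    and C: "C1 \<in> components (stereo ` (K - sphere_of x))" "C2 \<in> components (stereo ` (K - sphere_of x))"
    and sub: "C1 \<subseteq> stereo ` int_ball_of x" "C2 \<subseteq> stereo ` int_ball_of x"
    unfolding NT_def by blast
  have "stereo ` g ` (K - sphere_of x) = stereo ` (g ` K - sphere_of (reflect n x))"
    by (simp add: sphere_of_reflect image_set_diff[OF inj])
  note C' = C[THEN components_sphere_map, unfolded this]
  have inj': "inj_on sphere_map (range stereo)"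
    by (rule inj_onI) (metis sphere_map_stereo involution rangeE)
  have "sphere_map ` C1 \<noteq> sphere_map ` C2"
  proof -
    have "C1 \<subseteq> range stereo" "C2 \<subseteq> range stereo" using sub by auto
    then show ?thesis using ne by (simp add: inj_on_image_eq_iff[OF inj'])
  qed
  moreover have "sphere_map ` C1 \<subseteq> stereo ` int_ball_of (reflect n x)"
    "sphere_map ` C2 \<subseteq> stereo ` int_ball_of (reflect n x)"
    using sub[THEN image_mono, of sphere_map] by (simp_all only: sphere_map_image int_ball_of_reflect)
  ultimately show ?thesis
    unfolding NT_def mem_Collect_eq using x reflect_oriented_spheres[OF n] C'
    by (intro conjI exI[of _ "sphere_map ` C1"] exI[of _ "sphere_map ` C2"]) simp_all
qed

lemma NT_reflect_iff: "reflect n x \<in> NT (g ` K) \<longleftrightarrow> x \<in> NT K"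
  using NT_reflect[of x K] NT_reflect[of "reflect n x" "g ` K"]
  by (auto simp: reflect_reflect[OF n] image_image)

lemma mnts_reflection:
  "mnts1 (g ` K) = mnts1 K" "mnts (g ` K) = mnts K" "mnts4 (g ` K) = mnts4 K"
proof -
  note T = dSigma_reflect(1,2)[OF n]
  show "mnts1 (g ` K) = mnts1 K"
    unfolding mnts1_def NT_bar_image
    by (rule emeasure_involution[OF T reflect_reflect[OF n]])
       (auto simp: dSigma_reflect(3)[OF n] NT_bar_def)
  have int: "(\<integral>\<^sup>+x \<in> NT (g ` K). F (half_count (g ` K) x) \<partial>dSigma)
      = (\<integral>\<^sup>+x \<in> NT K. F (half_count K x) \<partial>dSigma)" for F :: "ennreal \<Rightarrow> ennreal"
  proof -
    have "(\<integral>\<^sup>+x \<in> NT (g ` K). F (half_count (g ` K) x) \<partial>dSigma)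
      = (\<integral>\<^sup>+x. F (half_count (g ` K) (reflect n x)) * indicator (NT (g ` K)) (reflect n x) \<partial>dSigma)"
      by (rule nn_integral_involution[OF T reflect_reflect[OF n], symmetric])
    then show ?thesis
      by (simp add: half_count_def intersection_count_reflect indicator_def NT_reflect_iff)
  qed
  show "mnts (g ` K) = mnts K" unfolding mnts_def by (rule int)
  show "mnts4 (g ` K) = mnts4 K" unfolding mnts4_def by (rule int)
qed

end


section \<open>Inversions and plane reflections are Lorentz reflections\<close>

lemma reflect_light_Some:
  assumes "reflect n (null_vec p) = k *\<^sub>R light z" "k > 0"
  shows "\<exists>w>0. reflect n (light (Some p)) = w *\<^sub>R light z"
  using assms norm_sq_plus_1[of p]
  by (intro exI[of _ "k / ((norm p)\<^sup>2 + 1)"]) (simp add: light_Some linear_scale[OF linear_reflect])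

lemma null_light: "null_vec p = ((norm p)\<^sup>2 + 1) *\<^sub>R light (Some p)"
  using norm_sq_plus_1[of p] by (simp add: light_Some)

text \<open>The vector \<open>n\<close> represents the sphere of inversion.  Finite points are sent to finite points with
  the factor \<open>d / r\<^sup>2\<close> between the polynomial light vectors, \<open>d\<close> being the squared distance from
  the centre; the centre and \<open>\<infinity>\<close> are exchanged.\<close>

lemma sphere_reflection_inversion:
  assumes r: "r > 0"
  shows "\<exists>n. sphere_reflection n (inversion c r)"
proof -
  define m :: "real^5" where
    "m = vector [c$1, c$2, c$3, ((norm c)\<^sup>2 - r\<^sup>2 - 1) / 2, ((norm c)\<^sup>2 - r\<^sup>2 + 1) / 2]"
  define n where "n = (1 / r) *\<^sub>R m"
  have n: "n \<in> oriented_spheres"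
    using sphere_of_euclidean(1)[OF r, of 1 c] by (simp add: n_def m_def)
  have reflect_n: "reflect n x = x - (2 * lorentz x m / r\<^sup>2) *\<^sub>R m" for x
    by (simp add: reflect_def n_def lorentz_scale_right power2_eq_square)
  have at_infinity: "\<exists>w>0. reflect n (light None) = w *\<^sub>R light (Some c)"
  proof -
    have "lorentz (light None) m = -1" by (simp add: light_None m_def lorentz_def field_simps)
    then have "reflect n (light None) = light None + (2 / r\<^sup>2) *\<^sub>R m" by (simp add: reflect_n)
    also have "\<dots> = (1 / r\<^sup>2) *\<^sub>R null_vec c"
      using r by (simp add: vec_eq_iff forall_5 light_None null_vec_def m_def field_simps)
    finally show ?thesis unfolding null_light using r norm_sq_plus_1[of c]
      by (intro exI[of _ "1 / r\<^sup>2 * ((norm c)\<^sup>2 + 1)"]) auto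
  qed
  have l: "lorentz (null_vec p) m = r\<^sup>2 - (norm (p - c))\<^sup>2" for p
  proof -
    have "lorentz (null_vec p) m = 2 * (c$1 * p$1 + c$2 * p$2 + c$3 * p$3) + r\<^sup>2 - (norm c)\<^sup>2 - (norm p)\<^sup>2"
      by (simp add: null_vec_def m_def lorentz_def field_simps)
    then show ?thesis unfolding norm_sq_3 by (simp add: power2_eq_square algebra_simps)
  qed
  have centre: "reflect n (null_vec c) = r\<^sup>2 *\<^sub>R light None"
  proof -
    have "reflect n (null_vec c) = null_vec c - 2 *\<^sub>R m" using r by (simp add: reflect_n l)
    then show ?thesis by (simp add: vec_eq_iff forall_5 light_None null_vec_def m_def field_simps)
  qed
  have other: "\<exists>k>0. reflect n (null_vec p) = k *\<^sub>R light (inversion c r (Some p))" if p: "p \<noteq> c" for p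
  proof -
    define d where "d = (norm (p - c))\<^sup>2"
    have d: "d > 0" using p by (simp add: d_def)
    define q where "q = c + (r\<^sup>2 / d) *\<^sub>R (p - c)"
    \<comment> \<open>The last two coordinates of the claim are linear combinations of this identity and a trivial one.\<close>
    have nq: "d * (norm q)\<^sup>2 = d * (norm c)\<^sup>2 + r\<^sup>2 * ((norm p)\<^sup>2 - (norm c)\<^sup>2 - d) + r\<^sup>2 * r\<^sup>2"
    proof -
      have "(norm q)\<^sup>2 = (norm c)\<^sup>2 + (2 * (r\<^sup>2 / d)) * (c \<bullet> (p - c)) + (r\<^sup>2 / d)\<^sup>2 * d"
      proof -
        have "(norm (c + t *\<^sub>R v))\<^sup>2 = (norm c)\<^sup>2 + (2 * t) * (c \<bullet> v) + t\<^sup>2 * (norm v)\<^sup>2" for t and v :: "real^3"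
          unfolding power2_norm_eq_inner
          by (simp add: inner_add_left inner_add_right inner_commute power2_eq_square)
        then show ?thesis unfolding q_def d_def .
      qed
      moreover have "2 * (c \<bullet> (p - c)) = (norm p)\<^sup>2 - (norm c)\<^sup>2 - d"
        unfolding d_def power2_norm_eq_inner by (simp add: inner_diff inner_commute)
      ultimately have "(norm q)\<^sup>2 = (norm c)\<^sup>2 + (r\<^sup>2 / d) * ((norm p)\<^sup>2 - (norm c)\<^sup>2 - d) + (r\<^sup>2 / d)\<^sup>2 * d"
        by simp
      then show ?thesis using d by (simp add: field_simps power2_eq_square)
    qed
    have "r\<^sup>2 *\<^sub>R reflect n (null_vec p) = r\<^sup>2 *\<^sub>R null_vec p - (2 * (r\<^sup>2 - d)) *\<^sub>R m"
      using r by (simp add: reflect_n l d_def scaleR_diff_right)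
    also have "\<dots> = d *\<^sub>R null_vec q"
    proof -
      have "d *\<^sub>R q = d *\<^sub>R c + r\<^sup>2 *\<^sub>R (p - c)"
        using d by (simp add: q_def scaleR_add_right)
      then have q: "d * q$i = d * c$i + r\<^sup>2 * (p$i - c$i)" for i
        by (metis vector_add_component vector_minus_component vector_scaleR_component real_scaleR_def)
      have m: "(2 * t) *\<^sub>R m =
          t *\<^sub>R vector [2 * c$1, 2 * c$2, 2 * c$3, (norm c)\<^sup>2 - r\<^sup>2 - 1, (norm c)\<^sup>2 - r\<^sup>2 + 1]" for t
        by (simp add: m_def vec_eq_iff forall_5)
      have "r\<^sup>2 * (2 * p$i) - (r\<^sup>2 - d) * (2 * c$i) = d * (2 * q$i)" for i
        using q[of i] by algebra
      moreover have "r\<^sup>2 * ((norm p)\<^sup>2 - 1) - (r\<^sup>2 - d) * ((norm c)\<^sup>2 - r\<^sup>2 - 1) = d * ((norm q)\<^sup>2 - 1)"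
        using nq by algebra
      moreover have "r\<^sup>2 * ((norm p)\<^sup>2 + 1) - (r\<^sup>2 - d) * ((norm c)\<^sup>2 - r\<^sup>2 + 1) = d * ((norm q)\<^sup>2 + 1)"
        using nq by algebra
      ultimately show ?thesis unfolding m by (simp add: vec_eq_iff forall_5 null_vec_def)
    qed
    finally have e: "r\<^sup>2 *\<^sub>R reflect n (null_vec p) = d *\<^sub>R null_vec q" .
    have "reflect n (null_vec p) = (1 / r\<^sup>2) *\<^sub>R (r\<^sup>2 *\<^sub>R reflect n (null_vec p))" using r by simp
    also have "\<dots> = (d / r\<^sup>2) *\<^sub>R null_vec q" unfolding e by simp
    finally have "reflect n (null_vec p) = (d / r\<^sup>2) *\<^sub>R null_vec q" .
    moreover have "inversion c r (Some p) = Some q" using p by (simp add: q_def d_def)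
    ultimately show ?thesis using d r norm_sq_plus_1[of q]
      by (intro exI[of _ "d / r\<^sup>2 * ((norm q)\<^sup>2 + 1)"]) (simp add: null_light)
  qed
  have "\<exists>w>0. reflect n (light z) = w *\<^sub>R light (inversion c r z)" for z
  proof (cases z)
    case None
    then show ?thesis using at_infinity by simp
  next
    case (Some p)
    have "\<exists>k>0. reflect n (null_vec p) = k *\<^sub>R light (inversion c r (Some p))"
      using other centre r by (cases "p = c") (auto intro!: exI[of _ "r\<^sup>2"])
    then show ?thesis unfolding Some using reflect_light_Some by blast
  qed
  then have "sphere_reflection n (inversion c r)" using n by unfold_locales
  then show ?thesis ..
qed

text \<open>A plane is a sphere through \<open>\<infinity>\<close>, that is, its vector is orthogonal to \<open>light None = (0, 0, 0, 1, 1)\<close>;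
  this is why its last two coordinates agree.  The polynomial light vectors are mapped to each
  other with factor \<open>1\<close>.\<close>

lemma sphere_reflection_plane:
  assumes a: "a \<noteq> 0"
  shows "\<exists>n. sphere_reflection n (plane_reflection a b)"
proof -
  define m :: "real^5" where "m = vector [a$1, a$2, a$3, b, b]"
  define n where "n = (1 / norm a) *\<^sub>R m"
  have "lorentz m m = (norm a)\<^sup>2"
    unfolding norm_sq_3 by (simp add: m_def lorentz_def power2_eq_square)
  then have n: "n \<in> oriented_spheres"
    using a by (simp add: oriented_spheres_def n_def lorentz_scaleR power_divide)
  have reflect_n: "reflect n x = x - (2 * lorentz x m / (a \<bullet> a)) *\<^sub>R m" for x
    by (simp add: reflect_def n_def lorentz_scale_right power2_eq_square flip: power2_norm_eq_inner)
  have at_infinity: "reflect n (light None) = light None"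
    by (simp add: reflect_n light_None m_def lorentz_def)
  have l: "lorentz (null_vec p) m = 2 * (a \<bullet> p - b)" for p
    by (simp add: null_vec_def m_def lorentz_def inner_vec_def sum_3 algebra_simps)
  have at_point: "reflect n (null_vec p) = null_vec q" if q: "q = p - (2 * (a \<bullet> p - b) / (a \<bullet> a)) *\<^sub>R a" for p q
  proof -
    define t where "t = 2 * (a \<bullet> p - b) / (a \<bullet> a)"
    have qt: "q = p - t *\<^sub>R a" using q by (simp only: t_def)
    have "t * (a \<bullet> a) = 2 * (a \<bullet> p - b)" using a by (simp add: t_def)
    moreover have "(norm q)\<^sup>2 = (norm p)\<^sup>2 - 2 * t * (a \<bullet> p) + t * (t * (a \<bullet> a))"
      unfolding qt power2_norm_eq_inner
      by (simp add: inner_diff_left inner_diff_right inner_commute algebra_simps)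
    ultimately have nq: "(norm q)\<^sup>2 = (norm p)\<^sup>2 - 2 * t * b" by algebra
    have "reflect n (null_vec p) = null_vec p - (2 * t) *\<^sub>R m" by (simp add: reflect_n l t_def)
    also have "\<dots> = null_vec q"
      by (simp add: vec_eq_iff forall_5 null_vec_def m_def nq) (simp add: qt algebra_simps)
    finally show ?thesis .
  qed
  have "\<exists>w>0. reflect n (light z) = w *\<^sub>R light (plane_reflection a b z)" for z
  proof (cases z)
    case None
    then show ?thesis using at_infinity by (auto intro!: exI[of _ 1])
  next
    case (Some p)
    show ?thesis unfolding Some plane_reflection.simps
      by (rule reflect_light_Some[OF trans[OF at_point[OF refl] null_light] norm_sq_plus_1])
  qed
  then have "sphere_reflection n (plane_reflection a b)" using n by unfold_locales
  then show ?thesis ..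
qed

lemma sphere_reflection_of_generator:
  assumes "g \<in> sphere_reflections"
  obtains n where "sphere_reflection n g"
  using assms sphere_reflection_inversion sphere_reflection_plane
  unfolding sphere_reflections_def by blast

text \<open>Reflections are their own inverses, so the group they generate consists of their products.\<close>

lemma conformal_group_induct [consumes 1, case_names id reflection comp]:
  assumes "g \<in> conformal_group"
    and id: "P id"
    and reflection: "\<And>g n. sphere_reflection n g \<Longrightarrow> P g"
    and comp: "\<And>g h. P g \<Longrightarrow> P h \<Longrightarrow> P (g \<circ> h)"
  shows "P g"
proof -
  let ?G = "BijGroup (UNIV :: S3 set)"
  have Bij: "h \<in> Bij UNIV" and self_inverse: "inv\<^bsub>?G\<^esub> h = h" if h: "h \<in> sphere_reflections" for h
  proof -
    obtain n where "sphere_reflection n h" using sphere_reflection_of_generator[OF h] .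
    then interpret sphere_reflection n h .
    show *: "h \<in> Bij UNIV"
      using involuntory_imp_bij[of h] by (simp add: Bij_def)
    have "inv_into UNIV h = h" by (rule inv_equality[of h h]) simp_all
    then show "inv\<^bsub>?G\<^esub> h = h" by (simp add: inv_BijGroup[OF *] restrict_UNIV)
  qed
  have sub: "sphere_reflections \<subseteq> carrier ?G" using Bij by (simp add: BijGroup_def subset_iff)
  from assms(1)[unfolded conformal_group_def] show ?thesis
  proof (induction rule: generate.induct)
    case one
    have "\<one>\<^bsub>?G\<^esub> = id" by (simp add: BijGroup_def restrict_def fun_eq_iff)
    then show ?case using id by (simp only:)
  next
    case (incl h)
    obtain n where "sphere_reflection n h" using sphere_reflection_of_generator[OF incl] .
    then show ?case by (rule reflection)
  next
    case (inv h)
    obtain n where "sphere_reflection n h" using sphere_reflection_of_generator[OF inv] .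
    then show ?case unfolding self_inverse[OF inv] by (rule reflection)
  next
    case (eng h1 h2)
    have "h1 \<in> Bij UNIV" "h2 \<in> Bij UNIV"
      using eng.hyps[THEN group.generate_in_carrier[OF group_BijGroup sub]] by (simp_all add: BijGroup_def)
    then have "h1 \<otimes>\<^bsub>?G\<^esub> h2 = h1 \<circ> h2"
      by (simp add: BijGroup_def compose_def restrict_def fun_eq_iff)
    then show ?case using comp[OF eng.IH] by (simp only:)
  qed
qed

theorem claim6p3p2:
  fixes K :: "S3 set" and g :: "S3 \<Rightarrow> S3"
  assumes "knot K" and "g \<in> conformal_group"
  shows "mnts1 (g ` K) = mnts1 K \<and> mnts (g ` K) = mnts K \<and> mnts4 (g ` K) = mnts4 K"
proof -
  have "\<forall>K. mnts1 (g ` K) = mnts1 K \<and> mnts (g ` K) = mnts K \<and> mnts4 (g ` K) = mnts4 K"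
    using assms(2)
  proof (induction rule: conformal_group_induct)
    case id
    show ?case by simp
  next
    case (reflection g n)
    then show ?case by (simp add: sphere_reflection.mnts_reflection)
  next
    case (comp g h)
    then show ?case by (simp only: image_comp[symmetric] simp_thms)
  qed
  then show ?thesis by blast
qed

end
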